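(* Let $T>0$ be arbitrary and let the coefficients $(b,\sigma,f,g)$ satisfy the standing assumption (A). Assume that there exists a decoupling field $u$ for the FBSDE $$X_t=x+\int_0^t b(s,\Theta_s)\,ds+\int_0^t\sigma(s,\Theta_s)\,dB_s,\qquad Y_t=g(X_T)+\int_t^T f(s,\Theta_s)\,ds-\int_t^T Z_s\,dB_s,\quad t\in[0,T],$$ where $\Theta=(X,Y,Z)$ and $x\in\mathbb R$. Then this FBSDE has a unique solution $\Theta$ on $[0,T]$, and $Y_t=u(t,X_t)$ for $t\in[0,T]$.
   Context: Setting: $B$ is a one-dimensional standard Brownian motion on a probability space $(\Omega,\mathcal F,\mathbb P)$ and $\mathbb F=(\mathcal F_t)_{t\ge0}$ is its natural filtration augmented by the $\mathbb P$-null sets. All processes are real-valued. Solutions of FBSDEs are $\mathbb F$-progressively measurable, square-integrable processes $\Theta=(X,Y,Z)$. Standing assumption (A): (i) $b,\sigma,f:[0,T]\times\Omega\times\mathbb R^3\to\mathbb R$ are $\mathbb F$-progressively measurable for fixed $(x,y,z)$; $g:\mathbb R\times\Omega\to\mathbb R$ is $\mathcal F_T$-measurable for fixed $x$; and $$I_0^2:=\mathbb E\Big\{\Big(\int_0^T[|b|+|f|](t,0,0,0)\,dt\Big)^2+\int_0^T|\sigma|^2(t,0,0,0)\,dt+|g(0)|^2\Big\}<\infty.$$ (ii) $b,\sigma,f,g$ are uniformly Lipschitz continuous in the spatial variables, uniformly in $(t,\omega)$, with a common Lipschitz constant $K_0>0$. Definition (decoupling field): an $\mathbb F$-progressively measurable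 random field $u:[0,T]\times\mathbb R\times\Omega\to\mathbb R$ with $u(T,x)=g(x)$ is a decoupling field of the FBSDE if there exists a constant $\delta>0$ such that, for any $0\le t_1<t_2\le T$ with $t_2-t_1\le\delta$ and any $\eta\in L^2(\mathcal F_{t_1})$, the FBSDE $$X_t=\eta+\int_{t_1}^t b(s,\Theta_s)\,ds+\int_{t_1}^t\sigma(s,\Theta_s)\,dB_s,\qquad Y_t=u(t_2,X_{t_2})+\int_t^{t_2}f(s,\Theta_s)\,ds-\int_t^{t_2}Z_s\,dB_s,\quad t\in[t_1,t_2],$$ has a unique solution, and this solution satisfies $Y_t=u(t,X_t)$ for $t\in[t_1,t_2]$, $\mathbb P$-a.s. *)

theory Defs
  imports "HOL-Probability.Probability"
begin

locale brownian_motion = prob_space M for M :: "'w measure" +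
  fixes B :: "real \<Rightarrow> 'w \<Rightarrow> real"
  assumes measurable_B: "\<And>t. 0 \<le> t \<Longrightarrow> B t \<in> borel_measurable M"
    and B_zero: "AE \<omega> in M. B 0 \<omega> = 0"
    and B_continuous: "AE \<omega> in M. continuous_on {0..} (\<lambda>t. B t \<omega>)"
    and B_indep_increments:
      "\<And>(n::nat) \<tau>. 0 \<le> \<tau> 0 \<Longrightarrow> (\<forall>i<n. \<tau> i < \<tau> (Suc i)) \<Longrightarrow>
        indep_vars (\<lambda>_. borel) (\<lambda>i \<omega>. B (\<tau> (Suc i)) \<omega> - B (\<tau> i) \<omega>) {..<n}"
    and B_gaussian_increments:
      "\<And>s t. 0 \<le> s \<Longrightarrow> s < t \<Longrightarrow>
        distributed M lborel (\<lambda>\<omega>. B t \<omega> - B s \<omega>) (normal_density 0 (sqrt (t - s)))"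

text \<open>Only the \<open>\<sigma>\<close>-algebra and the carrier of the following measure spaces are used; they
  carry the zero measure. If \<open>M\<close> is complete, \<^term>\<open>null_sets M\<close> contains every subset of a
  null set.\<close>

definition augmented_filtration ::
    "'w measure \<Rightarrow> (real \<Rightarrow> 'w \<Rightarrow> real) \<Rightarrow> real \<Rightarrow> 'w measure" where
  "augmented_filtration M B t =
     sigma (space M)
       ({B s -` A \<inter> space M | s A. 0 \<le> s \<and> s \<le> t \<and> A \<in> sets borel} \<union> null_sets M)"

definition progressively_measurable_on ::
    "(real \<Rightarrow> 'w measure) \<Rightarrow> real \<Rightarrow> real \<Rightarrow> (real \<Rightarrow> 'w \<Rightarrow> real) \<Rightarrow> bool" where
  "progressively_measurable_on F t1 t2 H \<longleftrightarrow>
     (\<forall>t\<in>{t1..t2}. (\<lambda>(s, \<omega>). H s \<omega>) \<in>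
        borel_measurable (restrict_space borel {t1..t} \<Otimes>\<^sub>M F t))"

definition progressively_measurable_field_on ::
    "(real \<Rightarrow> 'w measure) \<Rightarrow> real \<Rightarrow> real \<Rightarrow> (real \<Rightarrow> real \<Rightarrow> 'w \<Rightarrow> real) \<Rightarrow> bool" where
  "progressively_measurable_field_on F t1 t2 u \<longleftrightarrow>
     (\<forall>t\<in>{t1..t2}. (\<lambda>(s, x, \<omega>). u s x \<omega>) \<in>
        borel_measurable (restrict_space borel {t1..t} \<Otimes>\<^sub>M borel \<Otimes>\<^sub>M F t))"

definition square_integrable_process_on ::
    "'w measure \<Rightarrow> real \<Rightarrow> real \<Rightarrow> (real \<Rightarrow> 'w \<Rightarrow> real) \<Rightarrow> bool" where
  "square_integrable_process_on M t1 t2 H \<longleftrightarrow>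
     (\<integral>\<^sup>+\<omega>. (\<integral>\<^sup>+s\<in>{t1..t2}. ennreal ((H s \<omega>)\<^sup>2) \<partial>lborel) \<partial>M) < \<infinity>"

text \<open>A simple integrand \<open>\<Sum>i<n. \<xi>\<^sub>i 1\<^bsub>(\<tau>\<^sub>i, \<tau>\<^sub>i\<^sub>+\<^sub>1]\<^esub>\<close> on \<open>[t\<^sub>1, t\<^sub>2]\<close>, given by \<open>n\<close>, \<open>\<tau>\<close> and \<open>\<xi>\<close>.\<close>

definition simple_integrand_on ::
    "(real \<Rightarrow> 'w measure) \<Rightarrow> real \<Rightarrow> real \<Rightarrow> nat \<Rightarrow> (nat \<Rightarrow> real) \<Rightarrow> (nat \<Rightarrow> 'w \<Rightarrow> real) \<Rightarrow> bool" where
  "simple_integrand_on F t1 t2 n \<tau> \<xi> \<longleftrightarrow>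
     \<tau> 0 = t1 \<and> \<tau> n = t2 \<and> (\<forall>i<n. \<tau> i \<le> \<tau> (Suc i)) \<and>
     (\<forall>i<n. \<xi> i \<in> borel_measurable (F (\<tau> i)) \<and>
            (\<exists>C. \<forall>\<omega>\<in>space (F (\<tau> i)). \<bar>\<xi> i \<omega>\<bar> \<le> C))"

definition simple_process ::
    "nat \<Rightarrow> (nat \<Rightarrow> real) \<Rightarrow> (nat \<Rightarrow> 'w \<Rightarrow> real) \<Rightarrow> real \<Rightarrow> 'w \<Rightarrow> real" where
  "simple_process n \<tau> \<xi> s \<omega> = (\<Sum>i<n. \<xi> i \<omega> * indicator {\<tau> i<..\<tau> (Suc i)} s)"

definition simple_ito_integral ::
    "(real \<Rightarrow> 'w \<Rightarrow> real) \<Rightarrow> nat \<Rightarrow> (nat \<Rightarrow> real) \<Rightarrow> (nat \<Rightarrow> 'w \<Rightarrow> real) \<Rightarrow> real \<Rightarrow> 'w \<Rightarrow> real" where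
  "simple_ito_integral B n \<tau> \<xi> t \<omega> =
     (\<Sum>i<n. \<xi> i \<omega> * (B (min t (\<tau> (Suc i))) \<omega> - B (min t (\<tau> i)) \<omega>))"

text \<open>\<open>I\<close> is (a version with almost surely continuous paths of) the process
  \<open>t \<mapsto> \<integral>\<^bsub>t\<^sub>1\<^esub>\<^bsup>t\<^esup> H\<^sub>s dB\<^sub>s\<close> on \<open>[t\<^sub>1, t\<^sub>2]\<close>, the \<open>L\<^sup>2\<close>-limit of integrals of simple
  integrands approximating \<open>H\<close> in \<open>L\<^sup>2(dt \<otimes> dP)\<close>.\<close>

definition has_ito_integral_on ::
    "'w measure \<Rightarrow> (real \<Rightarrow> 'w \<Rightarrow> real) \<Rightarrow> real \<Rightarrow> real \<Rightarrow>
     (real \<Rightarrow> 'w \<Rightarrow> real) \<Rightarrow> (real \<Rightarrow> 'w \<Rightarrow> real) \<Rightarrow> bool" where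
  "has_ito_integral_on M B t1 t2 H I \<longleftrightarrow>
     progressively_measurable_on (augmented_filtration M B) t1 t2 H \<and>
     square_integrable_process_on M t1 t2 H \<and>
     (\<forall>t\<in>{t1..t2}. I t \<in> borel_measurable (augmented_filtration M B t)) \<and>
     (AE \<omega> in M. continuous_on {t1..t2} (\<lambda>t. I t \<omega>)) \<and>
     (\<exists>n \<tau> \<xi>.
        (\<forall>k. simple_integrand_on (augmented_filtration M B) t1 t2 (n k) (\<tau> k) (\<xi> k)) \<and>
        (\<lambda>k::nat. \<integral>\<^sup>+\<omega>. (\<integral>\<^sup>+s\<in>{t1..t2}.
            ennreal ((H s \<omega> - simple_process (n k) (\<tau> k) (\<xi> k) s \<omega>)\<^sup>2) \<partial>lborel) \<partial>M)
          \<longlonglongrightarrow> 0 \<and>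
        (\<forall>t\<in>{t1..t2}.
          (\<lambda>k. \<integral>\<^sup>+\<omega>. ennreal ((I t \<omega> - simple_ito_integral B (n k) (\<tau> k) (\<xi> k) t \<omega>)\<^sup>2) \<partial>M)
            \<longlonglongrightarrow> 0))"

definition fbsde_standing_assumption ::
    "'w measure \<Rightarrow> (real \<Rightarrow> 'w \<Rightarrow> real) \<Rightarrow> real \<Rightarrow>
     (real \<Rightarrow> 'w \<Rightarrow> real \<times> real \<times> real \<Rightarrow> real) \<Rightarrow>
     (real \<Rightarrow> 'w \<Rightarrow> real \<times> real \<times> real \<Rightarrow> real) \<Rightarrow>
     (real \<Rightarrow> 'w \<Rightarrow> real \<times> real \<times> real \<Rightarrow> real) \<Rightarrow>
     (real \<Rightarrow> 'w \<Rightarrow> real) \<Rightarrow> bool" where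
  "fbsde_standing_assumption M B T b \<sigma> f g \<longleftrightarrow>
     (\<forall>\<theta>. progressively_measurable_on (augmented_filtration M B) 0 T (\<lambda>t \<omega>. b t \<omega> \<theta>) \<and>
          progressively_measurable_on (augmented_filtration M B) 0 T (\<lambda>t \<omega>. \<sigma> t \<omega> \<theta>) \<and>
          progressively_measurable_on (augmented_filtration M B) 0 T (\<lambda>t \<omega>. f t \<omega> \<theta>)) \<and>
     (\<forall>x. g x \<in> borel_measurable (augmented_filtration M B T)) \<and>
     (\<integral>\<^sup>+\<omega>. ((\<integral>\<^sup>+t\<in>{0..T}. ennreal (\<bar>b t \<omega> (0, 0, 0)\<bar> + \<bar>f t \<omega> (0, 0, 0)\<bar>) \<partial>lborel)\<^sup>2
           + (\<integral>\<^sup>+t\<in>{0..T}. ennreal (\<bar>\<sigma> t \<omega> (0, 0, 0)\<bar>\<^sup>2) \<partial>lborel)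
           + ennreal (\<bar>g 0 \<omega>\<bar>\<^sup>2)) \<partial>M) < \<infinity> \<and>
     (\<exists>K0>0. (\<forall>t\<in>{0..T}. \<forall>\<omega>\<in>space M.
                K0-lipschitz_on UNIV (b t \<omega>) \<and>
                K0-lipschitz_on UNIV (\<sigma> t \<omega>) \<and>
                K0-lipschitz_on UNIV (f t \<omega>)) \<and>
             (\<forall>\<omega>\<in>space M. K0-lipschitz_on UNIV (\<lambda>x. g x \<omega>)))"

text \<open>Solutions on \<open>[t\<^sub>1, t\<^sub>2]\<close> with initial value \<open>\<eta>\<close> and terminal condition
  \<open>Y\<^bsub>t\<^sub>2\<^esub> = h(X\<^bsub>t\<^sub>2\<^esub>)\<close>; the values of \<open>X\<close>, \<open>Y\<close>, \<open>Z\<close> outside \<open>[t\<^sub>1, t\<^sub>2]\<close> are irrelevant.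
  The processes \<open>I\<close> and \<open>J\<close> are the Ito integrals from \<open>t\<^sub>1\<close>, so that \<open>J\<^bsub>t\<^sub>2\<^esub> - J\<^sub>t\<close> is
  \<open>\<integral>\<^bsub>t\<^esub>\<^bsup>t\<^sub>2\<^esup> Z\<^sub>s dB\<^sub>s\<close>.\<close>

definition fbsde_solution ::
    "'w measure \<Rightarrow> (real \<Rightarrow> 'w \<Rightarrow> real) \<Rightarrow>
     (real \<Rightarrow> 'w \<Rightarrow> real \<times> real \<times> real \<Rightarrow> real) \<Rightarrow>
     (real \<Rightarrow> 'w \<Rightarrow> real \<times> real \<times> real \<Rightarrow> real) \<Rightarrow>
     (real \<Rightarrow> 'w \<Rightarrow> real \<times> real \<times> real \<Rightarrow> real) \<Rightarrow>
     real \<Rightarrow> real \<Rightarrow> ('w \<Rightarrow> real) \<Rightarrow> (real \<Rightarrow> 'w \<Rightarrow> real) \<Rightarrow>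
     (real \<Rightarrow> 'w \<Rightarrow> real) \<Rightarrow> (real \<Rightarrow> 'w \<Rightarrow> real) \<Rightarrow> (real \<Rightarrow> 'w \<Rightarrow> real) \<Rightarrow> bool" where
  "fbsde_solution M B b \<sigma> f t1 t2 \<eta> h X Y Z \<longleftrightarrow>
     (\<forall>H\<in>{X, Y, Z}. progressively_measurable_on (augmented_filtration M B) t1 t2 H \<and>
                   square_integrable_process_on M t1 t2 H) \<and>
     (AE \<omega> in M. set_integrable lborel {t1..t2} (\<lambda>s. b s \<omega> (X s \<omega>, Y s \<omega>, Z s \<omega>)) \<and>
                 set_integrable lborel {t1..t2} (\<lambda>s. f s \<omega> (X s \<omega>, Y s \<omega>, Z s \<omega>))) \<and>
     (\<exists>I J.
        has_ito_integral_on M B t1 t2 (\<lambda>s \<omega>. \<sigma> s \<omega> (X s \<omega>, Y s \<omega>, Z s \<omega>)) I \<and>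
        has_ito_integral_on M B t1 t2 Z J \<and>
        (AE \<omega> in M. \<forall>t\<in>{t1..t2}.
           X t \<omega> = \<eta> \<omega> + (LBINT s:{t1..t}. b s \<omega> (X s \<omega>, Y s \<omega>, Z s \<omega>)) + I t \<omega> \<and>
           Y t \<omega> = h (X t2 \<omega>) \<omega> + (LBINT s:{t..t2}. f s \<omega> (X s \<omega>, Y s \<omega>, Z s \<omega>))
                     - (J t2 \<omega> - J t \<omega>)))"

text \<open>Uniqueness means indistinguishability of \<open>X\<close> and \<open>Y\<close> and equality of \<open>Z\<close>
  \<open>dt \<otimes> dP\<close>-almost everywhere.\<close>

definition fbsde_has_unique_solution ::
    "'w measure \<Rightarrow> (real \<Rightarrow> 'w \<Rightarrow> real) \<Rightarrow>
     (real \<Rightarrow> 'w \<Rightarrow> real \<times> real \<times> real \<Rightarrow> real) \<Rightarrow>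
     (real \<Rightarrow> 'w \<Rightarrow> real \<times> real \<times> real \<Rightarrow> real) \<Rightarrow>
     (real \<Rightarrow> 'w \<Rightarrow> real \<times> real \<times> real \<Rightarrow> real) \<Rightarrow>
     real \<Rightarrow> real \<Rightarrow> ('w \<Rightarrow> real) \<Rightarrow> (real \<Rightarrow> 'w \<Rightarrow> real) \<Rightarrow> bool" where
  "fbsde_has_unique_solution M B b \<sigma> f t1 t2 \<eta> h \<longleftrightarrow>
     (\<exists>X Y Z. fbsde_solution M B b \<sigma> f t1 t2 \<eta> h X Y Z) \<and>
     (\<forall>X Y Z X' Y' Z'.
        fbsde_solution M B b \<sigma> f t1 t2 \<eta> h X Y Z \<longrightarrow>
        fbsde_solution M B b \<sigma> f t1 t2 \<eta> h X' Y' Z' \<longrightarrow>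
        (AE \<omega> in M. \<forall>t\<in>{t1..t2}. X t \<omega> = X' t \<omega> \<and> Y t \<omega> = Y' t \<omega>) \<and>
        (AE (s, \<omega>) in lborel \<Otimes>\<^sub>M M. s \<in> {t1..t2} \<longrightarrow> Z s \<omega> = Z' s \<omega>))"

definition decoupling_field ::
    "'w measure \<Rightarrow> (real \<Rightarrow> 'w \<Rightarrow> real) \<Rightarrow> real \<Rightarrow>
     (real \<Rightarrow> 'w \<Rightarrow> real \<times> real \<times> real \<Rightarrow> real) \<Rightarrow>
     (real \<Rightarrow> 'w \<Rightarrow> real \<times> real \<times> real \<Rightarrow> real) \<Rightarrow>
     (real \<Rightarrow> 'w \<Rightarrow> real \<times> real \<times> real \<Rightarrow> real) \<Rightarrow>
     (real \<Rightarrow> 'w \<Rightarrow> real) \<Rightarrow> (real \<Rightarrow> real \<Rightarrow> 'w \<Rightarrow> real) \<Rightarrow> bool" where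
  "decoupling_field M B T b \<sigma> f g u \<longleftrightarrow>
     progressively_measurable_field_on (augmented_filtration M B) 0 T u \<and>
     (AE \<omega> in M. \<forall>x. u T x \<omega> = g x \<omega>) \<and>
     (\<exists>\<delta>>0. \<forall>t1 t2 \<eta>.
        0 \<le> t1 \<longrightarrow> t1 < t2 \<longrightarrow> t2 \<le> T \<longrightarrow> t2 - t1 \<le> \<delta> \<longrightarrow>
        \<eta> \<in> borel_measurable (augmented_filtration M B t1) \<longrightarrow>
        integrable M (\<lambda>\<omega>. (\<eta> \<omega>)\<^sup>2) \<longrightarrow>
        fbsde_has_unique_solution M B b \<sigma> f t1 t2 \<eta> (u t2) \<and>
        (\<forall>X Y Z. fbsde_solution M B b \<sigma> f t1 t2 \<eta> (u t2) X Y Z \<longrightarrow>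
           (AE \<omega> in M. \<forall>t\<in>{t1..t2}. Y t \<omega> = u t (X t \<omega>) \<omega>)))"

end

theory Submission
  imports Defs
begin

text \<open>
  Cut \<open>[0, T]\<close> into intervals of length at most \<open>\<delta>\<close>. Solutions on adjacent intervals \<open>[a, m]\<close> and
  \<open>[m, c]\<close> with \<open>X\<^sub>m\<close> as the initial value on the right can be pasted, because on both sides the
  value of \<open>Y\<close> at \<open>m\<close> is \<open>u(m, X\<^sub>m)\<close>. Conversely, a solution on \<open>[a, c]\<close> restricts to \<open>[m, c]\<close>, where
  the decoupling property yields \<open>Y\<^sub>m = u(m, X\<^sub>m)\<close>; this makes its restriction to \<open>[a, m]\<close> a solution
  with terminal condition \<open>u(m, \<cdot>)\<close>. So uniqueness and \<open>Y\<^sub>t = u(t, X\<^sub>t)\<close> extend from the two pieces to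
  \<open>[a, c]\<close>. The value \<open>X\<^sub>m\<close> is an admissible initial value: the
  Lipschitz condition and the Cauchy-Schwarz inequality bound the drift integral in \<open>L\<^sup>2\<close>.
\<close>

section \<open>Square integrals\<close>

text \<open>The stochastic integral is a relation between an integrand and a process, witnessed by a
  sequence of simple integrands, and not an operator with linearity and isometry. Restriction and
  pasting are therefore carried out on the witnessing sequences: nodes of a partition are clamped to
  a subinterval, or two partitions are appended. Square integrability of \<open>X\<close> is meant
  with respect to dt times dP and says nothing about a fixed time m. The second moment of
  \<open>X m\<close> has to be read off the forward equation, which also requires one for the Ito
  integral at a fixed time. Two orders of reasoning coexist. The decoupling property must be used on
  the right piece before the left piece is known to solve an equation with terminal condition
  \<open>u m\<close>; uniqueness must be used on the left piece first, since only then do two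
  solutions start the right piece from the same value. As this value is random and depends on the
  solution, the right piece has to be decoupled for every admissible initial value, while the left
  piece needs only the given one. Hence the interval grows from 0 by one short cell on its
  right.\<close>

lemma ennreal_square_add_le:
  "ennreal ((x + y)\<^sup>2) \<le> 2 * ennreal (x\<^sup>2) + 2 * ennreal (y\<^sup>2)" for x y :: real
proof -
  have "(x + y)\<^sup>2 \<le> 2 * x\<^sup>2 + 2 * y\<^sup>2"
    using zero_le_power2[of "x - y"] by (simp add: power2_eq_square algebra_simps)
  from ennreal_leI[OF this] show ?thesis by (simp add: ennreal_mult ennreal_plus)
qed

lemma ennreal_add_square_le:
  fixes a b :: ennreal
  shows "(a + b)\<^sup>2 \<le> 2 * a\<^sup>2 + 2 * b\<^sup>2"
proof (cases a; cases b)
  fix x y :: real assume "a = ennreal x" "0 \<le> x" "b = ennreal y" "0 \<le> y"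
  moreover from this have "(a + b)\<^sup>2 = ennreal ((x + y)\<^sup>2)"
    by (simp add: ennreal_power flip: ennreal_plus)
  ultimately show ?thesis
    using ennreal_square_add_le[of x y] by (simp add: ennreal_power)
qed (auto simp: ennreal_mult_top)

text \<open>This replaces the triangle inequality in L2. Stated for extended nonnegative integrals,
  it can be applied before any second moment is known to be finite.\<close>

lemma nn_integral_square_add_le:
  fixes f g :: "'a \<Rightarrow> real"
  assumes [measurable]: "f \<in> borel_measurable M" "g \<in> borel_measurable M"
  shows "(\<integral>\<^sup>+x. ennreal ((f x + g x)\<^sup>2) \<partial>M)
    \<le> 2 * (\<integral>\<^sup>+x. ennreal ((f x)\<^sup>2) \<partial>M) + 2 * (\<integral>\<^sup>+x. ennreal ((g x)\<^sup>2) \<partial>M)"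
proof -
  have "(\<integral>\<^sup>+x. ennreal ((f x + g x)\<^sup>2) \<partial>M)
    \<le> (\<integral>\<^sup>+x. 2 * ennreal ((f x)\<^sup>2) + 2 * ennreal ((g x)\<^sup>2) \<partial>M)"
    by (intro nn_integral_mono ennreal_square_add_le)
  then show ?thesis by (simp add: nn_integral_add nn_integral_cmult)
qed

text \<open>The factors 2 are those of the squared sum: this closes every argument in which an
  approximation error splits into two vanishing errors.\<close>

lemma ennreal_tendsto_0_le:
  fixes a b c :: "nat \<Rightarrow> ennreal"
  assumes "a \<longlonglongrightarrow> 0" "b \<longlonglongrightarrow> 0" "\<And>k. c k \<le> 2 * a k + 2 * b k"
  shows "c \<longlonglongrightarrow> 0"
proof (rule tendsto_sandwich[of "\<lambda>_. 0"])
  have "(\<lambda>k. 2 * a k + 2 * b k) \<longlonglongrightarrow> 2 * 0 + 2 * 0"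
    by (intro tendsto_add ennreal_tendsto_cmult assms) auto
  then show "(\<lambda>k. 2 * a k + 2 * b k) \<longlonglongrightarrow> 0" by simp
qed (use assms in auto)

lemma nn_integral_square_sum_finite:
  fixes f :: "nat \<Rightarrow> 'a \<Rightarrow> real"
  assumes "\<And>i. i < n \<Longrightarrow> f i \<in> borel_measurable M"
    and "\<And>i. i < n \<Longrightarrow> (\<integral>\<^sup>+\<omega>. ennreal ((f i \<omega>)\<^sup>2) \<partial>M) < \<infinity>"
  shows "(\<integral>\<^sup>+\<omega>. ennreal ((\<Sum>i<n. f i \<omega>)\<^sup>2) \<partial>M) < \<infinity>"
  using assms
proof (induction n)
  case (Suc n)
  have "(\<integral>\<^sup>+\<omega>. ennreal (((\<Sum>i<n. f i \<omega>) + f n \<omega>)\<^sup>2) \<partial>M)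
    \<le> 2 * (\<integral>\<^sup>+\<omega>. ennreal ((\<Sum>i<n. f i \<omega>)\<^sup>2) \<partial>M) + 2 * (\<integral>\<^sup>+\<omega>. ennreal ((f n \<omega>)\<^sup>2) \<partial>M)"
    using Suc.prems by (intro nn_integral_square_add_le borel_measurable_sum) auto
  also have "\<dots> < \<infinity>"
    using Suc by (auto simp: ennreal_mult_less_top)
  finally show ?case by simp
qed simp

text \<open>Cauchy-Schwarz against the indicator of [a, c], whose square integrates to c - a. Only
  the cut-off integrand is assumed measurable, because a process on [a, c] is controlled inside that
  interval only.\<close>

lemma set_nn_integral_square_le:
  fixes a c :: real
  assumes V: "(\<lambda>s. ennreal \<bar>V s\<bar> * indicator {a..c} s) \<in> borel_measurable lborel" and "a \<le> c"
  shows "(\<integral>\<^sup>+s\<in>{a..c}. ennreal \<bar>V s\<bar> \<partial>lborel)\<^sup>2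
    \<le> ennreal (c - a) * (\<integral>\<^sup>+s\<in>{a..c}. ennreal ((V s)\<^sup>2) \<partial>lborel)"
proof -
  let ?i = "indicator {a..c} :: real \<Rightarrow> ennreal"
  have i: "?i \<in> borel_measurable lborel" by simp
  have "(\<integral>\<^sup>+s. ennreal \<bar>V s\<bar> * ?i s * ?i s \<partial>lborel)\<^sup>2
    \<le> (\<integral>\<^sup>+s. (ennreal \<bar>V s\<bar> * ?i s)\<^sup>2 \<partial>lborel) * (\<integral>\<^sup>+s. (?i s)\<^sup>2 \<partial>lborel)"
    by (rule Cauchy_Schwarz_nn_integral[OF V i])
  moreover have "ennreal \<bar>V s\<bar> * ?i s * ?i s = ennreal \<bar>V s\<bar> * ?i s"
    "(ennreal \<bar>V s\<bar> * ?i s)\<^sup>2 = ennreal ((V s)\<^sup>2) * ?i s" "(?i s)\<^sup>2 = ?i s" for s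
    by (auto simp: indicator_def ennreal_power)
  ultimately show ?thesis
    using \<open>a \<le> c\<close> by (simp add: nn_integral_indicator mult.commute)
qed

section \<open>Integrals over adjacent intervals\<close>

lemma set_integral_Icc_split:
  fixes h :: "real \<Rightarrow> real"
  assumes "set_integrable lborel {a..c} h" "a \<le> m" "m \<le> c"
  shows "(LBINT s:{a..c}. h s) = (LBINT s:{a..m}. h s) + (LBINT s:{m..c}. h s)"
proof -
  have un: "{a..m} \<union> {m..c} = {a..c}" using assms(2,3) by auto
  have "AE s in lborel. \<not> (s \<in> {a..m} \<and> s \<in> {m..c})"
    using AE_lborel_singleton[of m] by eventually_elim auto
  moreover have "set_integrable lborel {a..m} h" "set_integrable lborel {m..c} h"
    using assms by (auto intro: set_integrable_subset)
  ultimately show ?thesis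
    using set_integral_Un_AE[where M = lborel and A = "{a..m}" and B = "{m..c}" and f = h] by (simp add: un)
qed

text \<open>Both closed intervals contain m, so the sum of the cut-off functions differs from the
  pasted function there; one point does not affect integrability.\<close>

lemma set_integrable_glue:
  fixes h1 h2 :: "real \<Rightarrow> real"
  assumes "set_integrable lborel {a..m} h1" "set_integrable lborel {m..c} h2" "a \<le> m" "m \<le> c"
  shows "set_integrable lborel {a..c} (\<lambda>s. if s \<le> m then h1 s else h2 s)"
proof -
  have "integrable lborel (\<lambda>s. indicator {a..m} s * h1 s + indicator {m..c} s * h2 s)"
    using assms(1,2) by (simp add: set_integrable_def)
  then have "integrable lborel (\<lambda>s. indicator {a..c} s * (if s \<le> m then h1 s else h2 s))"
    by (rule integrable_discrete_difference[where X = "{m}", THEN iffD1, rotated -1])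
      (use assms(3,4) in \<open>auto simp: indicator_def\<close>)
  then show ?thesis by (simp add: set_integrable_def)
qed

lemma set_integral_glue_left:
  fixes h1 h2 :: "real \<Rightarrow> real"
  assumes "A \<subseteq> {..m}"
  shows "(LBINT s:A. if s \<le> m then h1 s else h2 s) = (LBINT s:A. h1 s)"
  using assms unfolding set_lebesgue_integral_def
  by (intro Bochner_Integration.integral_cong) (auto simp: indicator_def)

text \<open>The set may contain m, where the pasted function still takes the value of
  \<open>h1\<close>; this point is discarded as a null set.\<close>

lemma set_integral_glue_right:
  fixes h1 h2 :: "real \<Rightarrow> real"
  assumes "A \<subseteq> {m..}"
  shows "(LBINT s:A. if s \<le> m then h1 s else h2 s) = (LBINT s:A. h2 s)"
  using assms unfolding set_lebesgue_integral_def
  by (intro integral_discrete_difference[where X = "{m}"]) (auto simp: indicator_def)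

lemma set_integral_Icc_singleton: "(LBINT s:{r..r}. h s) = (0::real)" for r :: real
  using set_integral_discrete_difference[of "{r}" "{r..r}" "{}" lborel h]
  by (simp add: set_lebesgue_integral_def)

section \<open>Simple integrands\<close>

lemma simple_integrand_times:
  assumes "simple_integrand_on F a c n \<tau> \<xi>" "i \<le> n"
  shows "a \<le> \<tau> i" "\<tau> i \<le> c"
proof -
  have step: "\<And>j. j < n \<Longrightarrow> \<tau> j \<le> \<tau> (Suc j)"
    and ends: "\<tau> 0 = a" "\<tau> n = c"
    using assms(1) by (auto simp: simple_integrand_on_def)
  show "a \<le> \<tau> i" using assms(2)
  proof (induction i)
    case (Suc j)
    then show ?case using step[of j] by simp
  qed (simp add: ends)
  \<comment> \<open>The upper bound is propagated backwards from the last node, where the value is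
    c.\<close>
  show "\<tau> i \<le> c" using assms(2)
  proof (induction rule: inc_induct)
    case (step j)
    then show ?case using \<open>\<And>j. j < n \<Longrightarrow> \<tau> j \<le> \<tau> (Suc j)\<close>[of j] by simp
  qed (simp add: ends)
qed

text \<open>All nodes lie at or after a, so for t at or before a both ends of every increment are
  truncated to t.\<close>

lemma simple_ito_integral_before:
  assumes S: "simple_integrand_on F a c n \<tau> \<xi>" and "t \<le> a"
  shows "simple_ito_integral W n \<tau> \<xi> t \<omega> = 0"
  unfolding simple_ito_integral_def
proof (intro sum.neutral ballI)
  fix i assume "i \<in> {..<n}"
  then have "min t (\<tau> i) = t" "min t (\<tau> (Suc i)) = t"
    using simple_integrand_times(1)[OF S, of i] simple_integrand_times(1)[OF S, of "Suc i"] \<open>t \<le> a\<close>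
    by auto
  then show "\<xi> i \<omega> * (W (min t (\<tau> (Suc i))) \<omega> - W (min t (\<tau> i)) \<omega>) = 0" by simp
qed

lemma simple_ito_integral_after:
  assumes S: "simple_integrand_on F a c n \<tau> \<xi>" and "c \<le> t"
  shows "simple_ito_integral W n \<tau> \<xi> t \<omega> = simple_ito_integral W n \<tau> \<xi> c \<omega>"
  unfolding simple_ito_integral_def
proof (intro sum.cong refl)
  fix i assume "i \<in> {..<n}"
  then have "min t (\<tau> i) = min c (\<tau> i)" "min t (\<tau> (Suc i)) = min c (\<tau> (Suc i))"
    using simple_integrand_times(2)[OF S, of i] simple_integrand_times(2)[OF S, of "Suc i"] \<open>c \<le> t\<close>
    by auto
  then show "\<xi> i \<omega> * (W (min t (\<tau> (Suc i))) \<omega> - W (min t (\<tau> i)) \<omega>)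
    = \<xi> i \<omega> * (W (min c (\<tau> (Suc i))) \<omega> - W (min c (\<tau> i)) \<omega>)" by simp
qed

text \<open>The cells are open on the left, so the process vanishes at a as well. This lets two
  simple processes meet at a common node without being counted twice there.\<close>

lemma simple_process_outside:
  assumes S: "simple_integrand_on F a c n \<tau> \<xi>" and "s \<notin> {a<..c}"
  shows "simple_process n \<tau> \<xi> s \<omega> = 0"
  unfolding simple_process_def
proof (intro sum.neutral ballI)
  fix i assume "i \<in> {..<n}"
  then have "s \<notin> {\<tau> i<..\<tau> (Suc i)}"
    using simple_integrand_times(1)[OF S, of i] simple_integrand_times(2)[OF S, of "Suc i"] assms(2)
    by auto
  then show "\<xi> i \<omega> * indicator {\<tau> i<..\<tau> (Suc i)} s = 0" by simp
qed

lemma sum_lessThan_add: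
  fixes f :: "nat \<Rightarrow> 'b::comm_monoid_add"
  shows "(\<Sum>i<m + n. f i) = (\<Sum>i<m. f i) + (\<Sum>i<n. f (m + i))"
  by (induction n) (simp_all add: add.assoc)

lemma simple_integrand_on_append:
  assumes S1: "simple_integrand_on F a m n1 \<tau>1 \<xi>1" and S2: "simple_integrand_on F m c n2 \<tau>2 \<xi>2"
  defines "\<tau> \<equiv> \<lambda>i. if i \<le> n1 then \<tau>1 i else \<tau>2 (i - n1)"
    and "\<xi> \<equiv> \<lambda>i. if i < n1 then \<xi>1 i else \<xi>2 (i - n1)"
  shows "simple_integrand_on F a c (n1 + n2) \<tau> \<xi>"
    and "simple_process (n1 + n2) \<tau> \<xi> s \<omega> = simple_process n1 \<tau>1 \<xi>1 s \<omega> + simple_process n2 \<tau>2 \<xi>2 s \<omega>"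
    and "simple_ito_integral W (n1 + n2) \<tau> \<xi> t \<omega>
      = simple_ito_integral W n1 \<tau>1 \<xi>1 t \<omega> + simple_ito_integral W n2 \<tau>2 \<xi>2 t \<omega>"
proof -
  have ends: "\<tau>1 0 = a" "\<tau>1 n1 = m" "\<tau>2 0 = m" "\<tau>2 n2 = c"
    using S1 S2 by (auto simp: simple_integrand_on_def)
  have 1: "\<tau> i = \<tau>1 i" if "i \<le> n1" for i using that by (simp add: \<tau>_def)
  \<comment> \<open>At i = 0 the appended sequence takes its value from \<open>\<tau>1\<close>; the
    two sequences agree there because \<open>\<tau>1 n1\<close> and \<open>\<tau>2 0\<close> are
    both m.\<close>
  have 2: "\<tau> (n1 + i) = \<tau>2 i" for i using ends by (auto simp: \<tau>_def)
  have 5: "\<tau> (Suc (n1 + i)) = \<tau>2 (Suc i)" for i using 2[of "Suc i"] by simp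
  have 3: "\<xi> i = \<xi>1 i" if "i < n1" for i using that by (simp add: \<xi>_def)
  have 4: "\<xi> (n1 + i) = \<xi>2 i" for i by (simp add: \<xi>_def)
  have "\<tau> i \<le> \<tau> (Suc i) \<and> \<xi> i \<in> borel_measurable (F (\<tau> i)) \<and> (\<exists>C. \<forall>\<omega>\<in>space (F (\<tau> i)). \<bar>\<xi> i \<omega>\<bar> \<le> C)"
    if "i < n1 + n2" for i
  proof (cases "i < n1")
    case True
    then show ?thesis using S1 1[of i] 1[of "Suc i"] 3[of i] by (simp add: simple_integrand_on_def)
  next
    case False
    define j where "j = i - n1"
    have "i = n1 + j" "j < n2" using that False by (auto simp: j_def)
    then show ?thesis using S2 2[of j] 5[of j] 4[of j] by (simp add: simple_integrand_on_def)
  qed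
  then show "simple_integrand_on F a c (n1 + n2) \<tau> \<xi>"
    using ends 1[of 0] 2[of n2] by (simp add: simple_integrand_on_def)
  show "simple_process (n1 + n2) \<tau> \<xi> s \<omega> = simple_process n1 \<tau>1 \<xi>1 s \<omega> + simple_process n2 \<tau>2 \<xi>2 s \<omega>"
    unfolding simple_process_def sum_lessThan_add 2 5 4
    by (intro arg_cong2[of _ _ _ _ "(+)"] sum.cong refl) (simp add: 1 3)
  show "simple_ito_integral W (n1 + n2) \<tau> \<xi> t \<omega>
      = simple_ito_integral W n1 \<tau>1 \<xi>1 t \<omega> + simple_ito_integral W n2 \<tau>2 \<xi>2 t \<omega>"
    unfolding simple_ito_integral_def sum_lessThan_add 2 5 4
    by (intro arg_cong2[of _ _ _ _ "(+)"] sum.cong refl) (simp add: 1 3)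
qed

context brownian_motion
begin

section \<open>Progressively measurable processes\<close>

abbreviation \<F> :: "real \<Rightarrow> 'w measure" where "\<F> \<equiv> augmented_filtration M B"

lemma filtration_generator_subset:
  "{B s -` A \<inter> space M |s A. 0 \<le> s \<and> s \<le> t \<and> A \<in> sets borel} \<union> null_sets M \<subseteq> sets M"
  using measurable_sets[OF measurable_B] by (auto simp: null_sets_def)

lemma filtration_generator_Pow:
  "{B s -` A \<inter> space M |s A. 0 \<le> s \<and> s \<le> t \<and> A \<in> sets borel} \<union> null_sets M \<subseteq> Pow (space M)"
  using filtration_generator_subset sets.space_closed by blast

lemma space_filtration [simp]: "space (\<F> t) = space M"
  by (simp add: augmented_filtration_def space_measure_of_conv)

lemma sets_filtration:
  "sets (\<F> t) = sigma_sets (space M)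
     ({B s -` A \<inter> space M |s A. 0 \<le> s \<and> s \<le> t \<and> A \<in> sets borel} \<union> null_sets M)"
  unfolding augmented_filtration_def by (rule sets_measure_of[OF filtration_generator_Pow])

lemma sets_filtration_subset: "sets (\<F> t) \<subseteq> sets M"
  unfolding sets_filtration by (rule sets.sigma_sets_subset[OF filtration_generator_subset])

lemma sets_filtration_mono: "s \<le> t \<Longrightarrow> sets (\<F> s) \<subseteq> sets (\<F> t)"
  unfolding sets_filtration by (intro sigma_sets_mono' Un_mono order_refl Collect_mono) (metis order_trans)

lemma subalgebra_filtration: "subalgebra M (\<F> s)" "s \<le> t \<Longrightarrow> subalgebra (\<F> t) (\<F> s)"
  by (simp_all add: subalgebra_def sets_filtration_subset sets_filtration_mono)

lemmas measurable_filtration_M = measurable_from_subalg[OF subalgebra_filtration(1)]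

lemmas measurable_filtration_mono = measurable_from_subalg[OF subalgebra_filtration(2)]

lemma measurable_id_filtration: "s \<le> t \<Longrightarrow> (\<lambda>x. x) \<in> measurable (\<F> t) (\<F> s)"
  by (rule measurable_filtration_mono[OF _ measurable_ident[unfolded id_def]])

lemma measurable_id_M_filtration: "(\<lambda>x. x) \<in> measurable M (\<F> s)"
  by (rule measurable_filtration_M[OF measurable_ident[unfolded id_def]])

text \<open>Progressive measurability ties the time interval to the \<sigma>-algebra. Composition
  with the projection of the real line onto [a', c'] yields a function defined for all times, which
  can be viewed from any later \<sigma>-algebra and combined with other pieces.\<close>

lemma progressively_measurable_clamp:
  assumes "progressively_measurable_on \<F> a c H" "a \<le> a'" "a' \<le> c'" "c' \<le> c" "c' \<le> t"
  shows "(\<lambda>(s, \<omega>). H (max a' (min c' s)) \<omega>) \<in> borel_measurable (borel \<Otimes>\<^sub>M \<F> t)"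
proof -
  have H: "(\<lambda>(s, \<omega>). H s \<omega>) \<in> borel_measurable (restrict_space borel {a..c'} \<Otimes>\<^sub>M \<F> c')"
    using assms by (auto simp: progressively_measurable_on_def)
  have 1: "(\<lambda>s. max a' (min c' s)) \<in> measurable borel (restrict_space borel {a..c'})"
    using assms by (intro measurable_restrict_space2) auto
  have "(\<lambda>p. (max a' (min c' (fst p)), snd p))
      \<in> measurable (borel \<Otimes>\<^sub>M \<F> t) (restrict_space borel {a..c'} \<Otimes>\<^sub>M \<F> c')"
    by (intro measurable_Pair measurable_compose[OF measurable_fst 1]
        measurable_compose[OF measurable_snd]) (simp add: measurable_id_filtration assms)
  from measurable_compose[OF this H] show ?thesis by (simp add: case_prod_beta')
qed

lemma progressively_measurable_section:
  assumes "progressively_measurable_on \<F> a c H" "t \<in> {a..c}"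
  shows "H t \<in> borel_measurable (\<F> t)"
proof -
  have H: "(\<lambda>(s, \<omega>). H s \<omega>) \<in> borel_measurable (restrict_space borel {a..t} \<Otimes>\<^sub>M \<F> t)"
    using assms by (auto simp: progressively_measurable_on_def)
  have "(\<lambda>\<omega>. (t, \<omega>)) \<in> measurable (\<F> t) (restrict_space borel {a..t} \<Otimes>\<^sub>M \<F> t)"
    using assms by (intro measurable_Pair1') (simp add: space_restrict_space)
  from measurable_compose[OF this H] show ?thesis by simp
qed

lemma progressively_measurable_restrict:
  assumes "progressively_measurable_on \<F> a c H" "a \<le> a'" "c' \<le> c"
  shows "progressively_measurable_on \<F> a' c' H"
  unfolding progressively_measurable_on_def
proof
  fix t assume t: "t \<in> {a'..c'}"
  then have H: "(\<lambda>(s, \<omega>). H s \<omega>) \<in> borel_measurable (restrict_space borel {a..t} \<Otimes>\<^sub>M \<F> t)"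
    using assms by (auto simp: progressively_measurable_on_def)
  have "(\<lambda>p. p) \<in> measurable (restrict_space borel {a'..t} \<Otimes>\<^sub>M \<F> t) (restrict_space borel {a..t} \<Otimes>\<^sub>M \<F> t)"
  \<comment> \<open>The identity is written as a pair of projections so that the two coordinates can
    be treated separately.\<close>
  proof (rule measurable_cong[THEN iffD1])
    show "(\<lambda>p. (fst p, snd p)) \<in> measurable (restrict_space borel {a'..t} \<Otimes>\<^sub>M \<F> t) (restrict_space borel {a..t} \<Otimes>\<^sub>M \<F> t)"
      by (intro measurable_Pair measurable_snd measurable_compose[OF measurable_fst]
          measurable_restrict_space2 measurable_restrict_space1)
        (use assms in \<open>auto simp: space_restrict_space\<close>)
  qed simp
  from measurable_compose[OF this H]
  show "(\<lambda>(s, \<omega>). H s \<omega>) \<in> borel_measurable (restrict_space borel {a'..t} \<Otimes>\<^sub>M \<F> t)" by simp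
qed

lemma progressively_measurable_glue:
  assumes H1: "progressively_measurable_on \<F> a m H1" and H2: "progressively_measurable_on \<F> m c H2"
    and "a \<le> m" "m \<le> c"
  shows "progressively_measurable_on \<F> a c (\<lambda>s \<omega>. if s \<le> m then H1 s \<omega> else H2 s \<omega>)"
  unfolding progressively_measurable_on_def
proof
  fix t assume t: "t \<in> {a..c}"
  show "(\<lambda>(s, \<omega>). if s \<le> m then H1 s \<omega> else H2 s \<omega>)
      \<in> borel_measurable (restrict_space borel {a..t} \<Otimes>\<^sub>M \<F> t)" (is "?f \<in> borel_measurable ?N")
  proof (cases "t \<le> m")
    case True
    then have "(\<lambda>(s, \<omega>). H1 s \<omega>) \<in> borel_measurable ?N"
      using H1 t by (auto simp: progressively_measurable_on_def)
    then show ?thesis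
      by (rule measurable_cong[THEN iffD1, rotated])
        (use True in \<open>auto simp: space_pair_measure space_restrict_space\<close>)
  next
    case False
    \<comment> \<open>Past m the two pieces live on different time intervals. Their clamped versions
      are defined for all times, and each clamp is the identity wherever the case distinction
      selects that piece.\<close>
    have id: "(\<lambda>p. (fst p, snd p)) \<in> measurable ?N (borel \<Otimes>\<^sub>M \<F> t)"
      by (intro measurable_Pair measurable_snd measurable_compose[OF measurable_fst]
          measurable_restrict_space1) auto
    have 1: "(\<lambda>p. H1 (max a (min m (fst p))) (snd p)) \<in> borel_measurable ?N"
      using measurable_compose[OF id progressively_measurable_clamp[OF H1, of a m t]] assms t False
      by simp
    have 2: "(\<lambda>p. H2 (max m (min t (fst p))) (snd p)) \<in> borel_measurable ?N"
      using measurable_compose[OF id progressively_measurable_clamp[OF H2, of m t t]] assms t False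
      by simp
    have fst: "fst \<in> borel_measurable ?N"
      using measurable_compose[OF id measurable_fst] by simp
    have "(\<lambda>p. if fst p \<le> m then H1 (max a (min m (fst p))) (snd p)
        else H2 (max m (min t (fst p))) (snd p)) \<in> borel_measurable ?N"
      by (intro measurable_If 1 2 borel_measurable_le fst borel_measurable_const)
    then show ?thesis
      by (rule measurable_cong[THEN iffD1, rotated])
        (auto simp: space_pair_measure space_restrict_space max_def min_def)
  qed
qed

lemma progressively_measurable_joint:
  assumes "progressively_measurable_on \<F> a c H" "a \<le> c"
  shows "(\<lambda>p. indicator {a..c} (fst p) * H (fst p) (snd p)) \<in> borel_measurable (lborel \<Otimes>\<^sub>M M)"
proof -
  have id: "(\<lambda>p. (fst p, snd p)) \<in> measurable (lborel \<Otimes>\<^sub>M M) (borel \<Otimes>\<^sub>M \<F> c)"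
    by (intro measurable_Pair measurable_compose[OF measurable_snd measurable_id_M_filtration])
      auto
  have "(\<lambda>p. H (max a (min c (fst p))) (snd p)) \<in> borel_measurable (lborel \<Otimes>\<^sub>M M)"
    using measurable_compose[OF id progressively_measurable_clamp[OF assms(1), of a c c]] assms
    by simp
  then have "(\<lambda>p. indicator {a..c} (fst p) * H (max a (min c (fst p))) (snd p))
      \<in> borel_measurable (lborel \<Otimes>\<^sub>M M)"
    by (intro borel_measurable_times measurable_compose[OF measurable_fst]) auto
  also have "(\<lambda>p. indicator {a..c} (fst p) * H (max a (min c (fst p))) (snd p))
      = (\<lambda>p. indicator {a..c} (fst p) * H (fst p) (snd p))"
    by (auto simp: fun_eq_iff indicator_def max_def min_def)
  finally show ?thesis .
qed

text \<open>Measurability is available only for the process multiplied by the indicator, and \<phi>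
  may be nonzero at 0. The outer indicator hides the difference between \<phi> of the process and
  \<phi> of its cut-off version; Tonelli then gives measurability in \<omega>, and sections give it
  in s.\<close>

lemma set_nn_integral_process_measurable:
  fixes \<phi> :: "real \<Rightarrow> real" and a c :: real
  assumes "(\<lambda>p. indicator {a..c} (fst p) * H (fst p) (snd p) :: real) \<in> borel_measurable (lborel \<Otimes>\<^sub>M M)"
    and \<phi>: "\<phi> \<in> borel_measurable borel"
  shows "(\<lambda>\<omega>. \<integral>\<^sup>+s\<in>{a..c}. ennreal (\<phi> (H s \<omega>)) \<partial>lborel) \<in> borel_measurable M"
    and "\<omega> \<in> space M \<Longrightarrow> (\<lambda>s. ennreal (\<phi> (H s \<omega>)) * indicator {a..c} s) \<in> borel_measurable lborel"
proof -
  have eq: "ennreal (\<phi> (indicator {a..c} s * H s \<omega>)) * indicator {a..c} s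
      = ennreal (\<phi> (H s \<omega>)) * indicator {a..c} s" for s \<omega>
    by (simp add: indicator_def)
  have "(\<lambda>p. ennreal (\<phi> (indicator {a..c} (fst p) * H (fst p) (snd p))) * indicator {a..c} (fst p))
      \<in> borel_measurable (lborel \<Otimes>\<^sub>M M)"
    by (intro borel_measurable_times_ennreal measurable_compose[OF measurable_compose[OF assms] measurable_ennreal]
        measurable_compose[OF measurable_fst borel_measurable_indicator]) simp
  then have m: "(\<lambda>p. ennreal (\<phi> (H (fst p) (snd p))) * indicator {a..c} (fst p)) \<in> borel_measurable (lborel \<Otimes>\<^sub>M M)"
    by (simp only: eq)
  have sw: "(\<lambda>(\<omega>, s). ennreal (\<phi> (H s \<omega>)) * indicator {a..c} s) \<in> borel_measurable (M \<Otimes>\<^sub>M lborel)"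
    using measurable_compose[OF measurable_pair_swap' m] by (simp add: case_prod_beta')
  from lborel.borel_measurable_nn_integral[OF sw]
  show "(\<lambda>\<omega>. \<integral>\<^sup>+s\<in>{a..c}. ennreal (\<phi> (H s \<omega>)) \<partial>lborel) \<in> borel_measurable M" by simp
  show "(\<lambda>s. ennreal (\<phi> (H s \<omega>)) * indicator {a..c} s) \<in> borel_measurable lborel" if "\<omega> \<in> space M"
    using measurable_compose[OF measurable_Pair2'[OF that] m] by simp
qed

section \<open>Restricting and pasting Ito integrals\<close>

lemma simple_integrand_measurable:
  assumes "simple_integrand_on \<F> a c n \<tau> \<xi>" "i < n"
  shows "\<xi> i \<in> borel_measurable M"
  using assms by (auto simp: simple_integrand_on_def intro: measurable_filtration_M)

lemma simple_ito_integral_measurable: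
  assumes "simple_integrand_on \<F> a c n \<tau> \<xi>" "0 \<le> a" "0 \<le> t"
  shows "simple_ito_integral B n \<tau> \<xi> t \<in> borel_measurable M"
  unfolding simple_ito_integral_def
proof (intro borel_measurable_sum borel_measurable_times borel_measurable_diff measurable_B)
  fix i assume "i \<in> {..<n}"
  then show "\<xi> i \<in> borel_measurable M" "0 \<le> min t (\<tau> i)" "0 \<le> min t (\<tau> (Suc i))"
    using simple_integrand_measurable[OF assms(1), of i] simple_integrand_times(1)[OF assms(1), of i]
      simple_integrand_times(1)[OF assms(1), of "Suc i"] assms(2,3) by auto
qed

lemma simple_process_measurable:
  assumes "simple_integrand_on \<F> a c n \<tau> \<xi>"
  shows "(\<lambda>p. simple_process n \<tau> \<xi> (fst p) (snd p)) \<in> borel_measurable (lborel \<Otimes>\<^sub>M M)"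
  unfolding simple_process_def
proof (intro borel_measurable_sum borel_measurable_times)
  fix i assume "i \<in> {..<n}"
  then show "(\<lambda>p. \<xi> i (snd p)) \<in> borel_measurable (lborel \<Otimes>\<^sub>M M)"
    using simple_integrand_measurable[OF assms, of i] by (auto intro: measurable_compose[OF measurable_snd])
  show "(\<lambda>p. indicator {\<tau> i<..\<tau> (Suc i)} (fst p)) \<in> borel_measurable (lborel \<Otimes>\<^sub>M M)"
    by (intro measurable_compose[OF measurable_fst]) auto
qed

lemma brownian_increment_square_finite:
  assumes "0 \<le> s" "0 \<le> t"
  shows "(\<integral>\<^sup>+\<omega>. ennreal ((B t \<omega> - B s \<omega>)\<^sup>2) \<partial>M) < \<infinity>"
proof -
  have less: "(\<integral>\<^sup>+\<omega>. ennreal ((B t \<omega> - B s \<omega>)\<^sup>2) \<partial>M) < \<infinity>" if "0 \<le> s" "s < t" for s t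
  proof -
    have "integrable lborel (\<lambda>x. normal_density 0 (sqrt (t - s)) x * x\<^sup>2)"
      using integrable_normal_moment[of "sqrt (t - s)" 0 2] that by simp
    then have "integrable M (\<lambda>\<omega>. (B t \<omega> - B s \<omega>)\<^sup>2)"
      using distributed_integrable[OF B_gaussian_increments[OF that], of "\<lambda>x. x\<^sup>2"] by simp
    then show ?thesis by (simp add: integrable_iff_bounded)
  qed
  \<comment> \<open>The Gaussian law is given for s < t. The reversed order has the same square, and
    equal times give the increment 0, which occurs when a partition has repeated nodes or is
    truncated.\<close>
  consider "s < t" | "t < s" | "s = t" by linarith
  then show ?thesis
  proof cases
    case 2
    then show ?thesis using less[of t s] assms by (simp add: power2_commute)
  qed (use less assms in auto)
qed

text \<open>Only finiteness is required, so each summand is bounded crudely: a bound C for the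
  coefficient contributes the factor \<open>C\<^sup>2\<close> to the second moment of the Brownian
  increment.\<close>

lemma simple_ito_integral_square_finite:
  assumes S: "simple_integrand_on \<F> a c n \<tau> \<xi>" and "0 \<le> a" "0 \<le> t"
  shows "(\<integral>\<^sup>+\<omega>. ennreal ((simple_ito_integral B n \<tau> \<xi> t \<omega>)\<^sup>2) \<partial>M) < \<infinity>"
  unfolding simple_ito_integral_def
proof (rule nn_integral_square_sum_finite)
  fix i assume i: "i < n"
  let ?D = "\<lambda>\<omega>. B (min t (\<tau> (Suc i))) \<omega> - B (min t (\<tau> i)) \<omega>"
  have nn: "0 \<le> min t (\<tau> i)" "0 \<le> min t (\<tau> (Suc i))"
    using i simple_integrand_times(1)[OF S, of i] simple_integrand_times(1)[OF S, of "Suc i"] assms(2,3)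
    by auto
  have D: "?D \<in> borel_measurable M" using nn by (intro borel_measurable_diff measurable_B)
  show "(\<lambda>\<omega>. \<xi> i \<omega> * ?D \<omega>) \<in> borel_measurable M"
    by (intro borel_measurable_times D simple_integrand_measurable[OF S i])
  obtain C where C: "\<And>\<omega>. \<omega> \<in> space M \<Longrightarrow> \<bar>\<xi> i \<omega>\<bar> \<le> C"
    using S i unfolding simple_integrand_on_def by (metis space_filtration)
  have "(\<integral>\<^sup>+\<omega>. ennreal ((\<xi> i \<omega> * ?D \<omega>)\<^sup>2) \<partial>M) \<le> (\<integral>\<^sup>+\<omega>. ennreal (C\<^sup>2) * ennreal ((?D \<omega>)\<^sup>2) \<partial>M)"
  proof (intro nn_integral_mono)
    fix \<omega> assume "\<omega> \<in> space M"
    then have "\<bar>\<xi> i \<omega>\<bar>\<^sup>2 \<le> C\<^sup>2" by (intro power_mono C) auto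
    then show "ennreal ((\<xi> i \<omega> * ?D \<omega>)\<^sup>2) \<le> ennreal (C\<^sup>2) * ennreal ((?D \<omega>)\<^sup>2)"
      by (auto simp: power_mult_distrib simp flip: ennreal_mult intro!: ennreal_leI mult_right_mono)
  qed
  also have "\<dots> = ennreal (C\<^sup>2) * (\<integral>\<^sup>+\<omega>. ennreal ((?D \<omega>)\<^sup>2) \<partial>M)"
    using D by (intro nn_integral_cmult) auto
  also have "\<dots> < \<infinity>"
    using brownian_increment_square_finite[OF nn] by (auto simp: ennreal_mult_less_top)
  finally show "(\<integral>\<^sup>+\<omega>. ennreal ((\<xi> i \<omega> * ?D \<omega>)\<^sup>2) \<partial>M) < \<infinity>" .
qed

section \<open>Approximating sequences of Ito integrals\<close>

text \<open>The last clause of \<open>has_ito_integral_on\<close> with the sequence as an explicit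
  argument, so that restriction and pasting can name the new sequence in terms of the old
  ones.\<close>

definition ito_approximation where
  "ito_approximation a c H I n \<tau> \<xi> \<longleftrightarrow>
     (\<forall>k. simple_integrand_on \<F> a c (n k) (\<tau> k) (\<xi> k)) \<and>
     (\<lambda>k::nat. \<integral>\<^sup>+\<omega>. (\<integral>\<^sup>+s\<in>{a..c}.
         ennreal ((H s \<omega> - simple_process (n k) (\<tau> k) (\<xi> k) s \<omega>)\<^sup>2) \<partial>lborel) \<partial>M) \<longlonglongrightarrow> 0 \<and>
     (\<forall>t\<in>{a..c}.
       (\<lambda>k. \<integral>\<^sup>+\<omega>. ennreal ((I t \<omega> - simple_ito_integral B (n k) (\<tau> k) (\<xi> k) t \<omega>)\<^sup>2) \<partial>M) \<longlonglongrightarrow> 0)"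

lemma has_ito_integral_on_iff:
  "has_ito_integral_on M B a c H I \<longleftrightarrow>
     progressively_measurable_on \<F> a c H \<and> square_integrable_process_on M a c H \<and>
     (\<forall>t\<in>{a..c}. I t \<in> borel_measurable (\<F> t)) \<and>
     (AE \<omega> in M. continuous_on {a..c} (\<lambda>t. I t \<omega>)) \<and>
     (\<exists>n \<tau> \<xi>. ito_approximation a c H I n \<tau> \<xi>)"
  unfolding has_ito_integral_on_def ito_approximation_def ..

lemma ito_approximationD:
  assumes "ito_approximation a c H I n \<tau> \<xi>"
  shows "simple_integrand_on \<F> a c (n k) (\<tau> k) (\<xi> k)"
    and "(\<lambda>k. \<integral>\<^sup>+\<omega>. (\<integral>\<^sup>+s\<in>{a..c}.
         ennreal ((H s \<omega> - simple_process (n k) (\<tau> k) (\<xi> k) s \<omega>)\<^sup>2) \<partial>lborel) \<partial>M) \<longlonglongrightarrow> 0"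
    and "t \<in> {a..c} \<Longrightarrow>
       (\<lambda>k. \<integral>\<^sup>+\<omega>. ennreal ((I t \<omega> - simple_ito_integral B (n k) (\<tau> k) (\<xi> k) t \<omega>)\<^sup>2) \<partial>M) \<longlonglongrightarrow> 0"
  using assms unfolding ito_approximation_def by blast+

lemma has_ito_integral_on_measurable:
  "has_ito_integral_on M B a c H I \<Longrightarrow> t \<in> {a..c} \<Longrightarrow> I t \<in> borel_measurable M"
  by (auto simp: has_ito_integral_on_def intro: measurable_filtration_M)

text \<open>One approximation with mean square error below 1 suffices: the integral is this error
  plus a simple integral, and both have finite second moment.\<close>

lemma has_ito_integral_on_square_finite:
  assumes "has_ito_integral_on M B a c H I" "0 \<le> a" "t \<in> {a..c}"
  shows "(\<integral>\<^sup>+\<omega>. ennreal ((I t \<omega>)\<^sup>2) \<partial>M) < \<infinity>"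
proof -
  obtain n \<tau> \<xi> where A: "ito_approximation a c H I n \<tau> \<xi>"
    using assms(1) unfolding has_ito_integral_on_iff by blast
  note S = ito_approximationD(1)[OF A] and lim = ito_approximationD(3)[OF A assms(3)]
  have "\<forall>\<^sub>F k in sequentially.
      (\<integral>\<^sup>+\<omega>. ennreal ((I t \<omega> - simple_ito_integral B (n k) (\<tau> k) (\<xi> k) t \<omega>)\<^sup>2) \<partial>M) < 1"
    using lim by (rule order_tendstoD) simp
  then obtain k where
    k: "(\<integral>\<^sup>+\<omega>. ennreal ((I t \<omega> - simple_ito_integral B (n k) (\<tau> k) (\<xi> k) t \<omega>)\<^sup>2) \<partial>M) < 1"
    by (auto simp: eventually_sequentially)
  let ?S = "simple_ito_integral B (n k) (\<tau> k) (\<xi> k) t"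
  have SM: "?S \<in> borel_measurable M"
    using assms by (intro simple_ito_integral_measurable[OF S]) auto
  have "(\<integral>\<^sup>+\<omega>. ennreal (((I t \<omega> - ?S \<omega>) + ?S \<omega>)\<^sup>2) \<partial>M) \<le>
     2 * (\<integral>\<^sup>+\<omega>. ennreal ((I t \<omega> - ?S \<omega>)\<^sup>2) \<partial>M) + 2 * (\<integral>\<^sup>+\<omega>. ennreal ((?S \<omega>)\<^sup>2) \<partial>M)"
    by (intro nn_integral_square_add_le borel_measurable_diff SM
        has_ito_integral_on_measurable[OF assms(1,3)])
  also have "\<dots> < \<infinity>"
    using simple_ito_integral_square_finite[OF S[of k] assms(2), of t] assms order.strict_trans[OF k ennreal_one_less_top]
    by (auto simp: ennreal_mult_less_top)
  finally show ?thesis by simp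
qed

text \<open>The start value is forced by the approximation: every simple integral vanishes at a, so
  the mean square error there is the constant second moment of \<open>I a\<close>, and a constant
  sequence tending to 0 is 0.\<close>

lemma has_ito_integral_on_start:
  assumes "has_ito_integral_on M B a c H I" "a \<le> c"
  shows "AE \<omega> in M. I a \<omega> = 0"
proof -
  obtain n \<tau> \<xi> where A: "ito_approximation a c H I n \<tau> \<xi>"
    using assms(1) unfolding has_ito_integral_on_iff by blast
  note S = ito_approximationD(1)[OF A] and lim = ito_approximationD(3)[OF A, of a]
  have "(\<lambda>k::nat. \<integral>\<^sup>+\<omega>. ennreal ((I a \<omega>)\<^sup>2) \<partial>M) \<longlonglongrightarrow> 0"
    using lim assms(2) by (simp add: simple_ito_integral_before[OF S])
  then have "(\<integral>\<^sup>+\<omega>. ennreal ((I a \<omega>)\<^sup>2) \<partial>M) = 0"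
    by (rule LIMSEQ_unique[OF tendsto_const])
  moreover have "I a \<in> borel_measurable M"
    using has_ito_integral_on_measurable[OF assms(1)] assms(2) by simp
  ultimately have "AE \<omega> in M. ennreal ((I a \<omega>)\<^sup>2) = 0"
    by (subst (asm) nn_integral_0_iff_AE) auto
  then show ?thesis by (rule AE_mp) (simp add: ennreal_eq_0_iff)
qed

section \<open>Restriction to a subinterval\<close>

lemma square_integrable_process_on_restrict:
  assumes "square_integrable_process_on M a c H" "a \<le> a'" "c' \<le> c"
  shows "square_integrable_process_on M a' c' H"
proof -
  have "(\<integral>\<^sup>+\<omega>. (\<integral>\<^sup>+s\<in>{a'..c'}. ennreal ((H s \<omega>)\<^sup>2) \<partial>lborel) \<partial>M)
      \<le> (\<integral>\<^sup>+\<omega>. (\<integral>\<^sup>+s\<in>{a..c}. ennreal ((H s \<omega>)\<^sup>2) \<partial>lborel) \<partial>M)"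
    using assms(2,3) by (intro nn_integral_mono mult_left_mono) (auto simp: indicator_def)
  also have "\<dots> < \<infinity>" using assms(1) by (simp add: square_integrable_process_on_def)
  finally show ?thesis by (simp add: square_integrable_process_on_def)
qed

text \<open>The coefficients are set to zero where \<open>\<tau> i \<ge> c'\<close>, because there they need not be measurable
  with respect to the filtration at time \<open>c'\<close>.\<close>

lemma simple_integrand_on_restrict:
  assumes S: "simple_integrand_on \<F> a c n \<tau> \<xi>" and "a \<le> a'" "a' \<le> c'" "c' \<le> c"
  defines "\<tau>' \<equiv> \<lambda>i. max a' (min c' (\<tau> i))" and "\<xi>' \<equiv> \<lambda>i \<omega>. if \<tau> i < c' then \<xi> i \<omega> else 0"
  shows "simple_integrand_on \<F> a' c' n \<tau>' \<xi>'"
    and "s \<in> {a'<..c'} \<Longrightarrow> simple_process n \<tau>' \<xi>' s \<omega> = simple_process n \<tau> \<xi> s \<omega>"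
    and "t \<in> {a'..c'} \<Longrightarrow> simple_ito_integral W n \<tau>' \<xi>' t \<omega>
      = simple_ito_integral W n \<tau> \<xi> t \<omega> - simple_ito_integral W n \<tau> \<xi> a' \<omega>"
proof -
  have \<xi>: "\<xi> i \<in> borel_measurable (\<F> (\<tau> i))" "\<exists>C. \<forall>\<omega>\<in>space M. \<bar>\<xi> i \<omega>\<bar> \<le> C" if "i < n" for i
    using S that unfolding simple_integrand_on_def by auto
  have step: "\<tau> i \<le> \<tau> (Suc i)" if "i < n" for i
    using S that unfolding simple_integrand_on_def by auto
  have "\<xi>' i \<in> borel_measurable (\<F> (\<tau>' i))" "\<exists>C. \<forall>\<omega>\<in>space M. \<bar>\<xi>' i \<omega>\<bar> \<le> C" if "i < n" for i
  proof -
    show "\<xi>' i \<in> borel_measurable (\<F> (\<tau>' i))"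
    proof (cases "\<tau> i < c'")
      case True
      then have "\<xi>' i = \<xi> i" "\<tau> i \<le> \<tau>' i" by (auto simp: \<xi>'_def \<tau>'_def)
      then show ?thesis using measurable_filtration_mono[OF _ \<xi>(1)[OF that]] by simp
    qed (simp add: \<xi>'_def)
    show "\<exists>C. \<forall>\<omega>\<in>space M. \<bar>\<xi>' i \<omega>\<bar> \<le> C"
      using \<xi>(2)[OF that] by (cases "\<tau> i < c'") (auto simp: \<xi>'_def)
  qed
  then show "simple_integrand_on \<F> a' c' n \<tau>' \<xi>'"
    using S assms(2-4) max.mono[OF order_refl min.mono[OF order_refl step]]
    unfolding simple_integrand_on_def by (auto simp: \<tau>'_def)
  show "simple_process n \<tau>' \<xi>' s \<omega> = simple_process n \<tau> \<xi> s \<omega>" if "s \<in> {a'<..c'}"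
    unfolding simple_process_def using that
    by (intro sum.cong refl) (auto simp: \<tau>'_def \<xi>'_def indicator_def)
  show "simple_ito_integral W n \<tau>' \<xi>' t \<omega>
      = simple_ito_integral W n \<tau> \<xi> t \<omega> - simple_ito_integral W n \<tau> \<xi> a' \<omega>" if t: "t \<in> {a'..c'}"
    unfolding simple_ito_integral_def sum_subtractf[symmetric]
  proof (intro sum.cong refl)
    fix i assume i: "i \<in> {..<n}"
    \<comment> \<open>For \<open>\<tau> j \<le> a'\<close> the clamped node is a' and the last term
      cancels the first. Otherwise truncation at t absorbs the clamp at c', because
      \<open>t \<le> c'\<close>, and the two terms at a' cancel. Differences over a cell thus give
      the original increment at t minus the one at a'.\<close>
    have W: "W (min t (\<tau>' j)) \<omega> = W (min t (\<tau> j)) \<omega> + W a' \<omega> - W (min a' (\<tau> j)) \<omega>" for j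
      using t by (cases "\<tau> j \<le> a'") (auto simp: \<tau>'_def min_def max_def)
    show "\<xi>' i \<omega> * (W (min t (\<tau>' (Suc i))) \<omega> - W (min t (\<tau>' i)) \<omega>) =
      \<xi> i \<omega> * (W (min t (\<tau> (Suc i))) \<omega> - W (min t (\<tau> i)) \<omega>)
      - \<xi> i \<omega> * (W (min a' (\<tau> (Suc i))) \<omega> - W (min a' (\<tau> i)) \<omega>)"
    proof (cases "\<tau> i < c'")
      case True
      then show ?thesis unfolding W by (simp add: \<xi>'_def algebra_simps)
    next
      case False
      \<comment> \<open>Here the node lies at or after c' and hence after or at t, so both original
        increments vanish, in agreement with the coefficient set to zero.\<close>
      then have "min t (\<tau> (Suc i)) = t" "min t (\<tau> i) = t" "min a' (\<tau> (Suc i)) = a'" "min a' (\<tau> i) = a'"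
        using step[of i] i t assms(2-4) by auto
      then show ?thesis using False by (simp add: \<xi>'_def)
    qed
  qed
qed

text \<open>Shrinking the interval cannot increase the integrand error. The error of the restricted
  integral at t is the old error at t minus the old error at a', so it vanishes in mean square as
  well.\<close>

lemma ito_approximation_restrict:
  assumes A: "ito_approximation a c H I n \<tau> \<xi>" and "0 \<le> a" "a \<le> a'" "a' \<le> c'" "c' \<le> c"
    and I: "\<And>t. t \<in> {a..c} \<Longrightarrow> I t \<in> borel_measurable M"
  shows "ito_approximation a' c' H (\<lambda>t \<omega>. I t \<omega> - I a' \<omega>) n
    (\<lambda>k i. max a' (min c' (\<tau> k i))) (\<lambda>k i \<omega>. if \<tau> k i < c' then \<xi> k i \<omega> else 0)"
    (is "ito_approximation a' c' H ?I n ?\<tau> ?\<xi>")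
  unfolding ito_approximation_def
proof (intro conjI allI ballI)
  note R = simple_integrand_on_restrict[OF ito_approximationD(1)[OF A] assms(3-5)]
  show "simple_integrand_on \<F> a' c' (n k) (?\<tau> k) (?\<xi> k)" for k
    by (rule R(1))
  show "(\<lambda>k. \<integral>\<^sup>+\<omega>. (\<integral>\<^sup>+s\<in>{a'..c'}.
         ennreal ((H s \<omega> - simple_process (n k) (?\<tau> k) (?\<xi> k) s \<omega>)\<^sup>2) \<partial>lborel) \<partial>M) \<longlonglongrightarrow> 0"
  proof (rule tendsto_sandwich[OF _ _ tendsto_const ito_approximationD(2)[OF A]])
    show "\<forall>\<^sub>F k in sequentially. (\<integral>\<^sup>+\<omega>. (\<integral>\<^sup>+s\<in>{a'..c'}.
         ennreal ((H s \<omega> - simple_process (n k) (?\<tau> k) (?\<xi> k) s \<omega>)\<^sup>2) \<partial>lborel) \<partial>M)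
      \<le> (\<integral>\<^sup>+\<omega>. (\<integral>\<^sup>+s\<in>{a..c}.
         ennreal ((H s \<omega> - simple_process (n k) (\<tau> k) (\<xi> k) s \<omega>)\<^sup>2) \<partial>lborel) \<partial>M)"
    proof (rule always_eventually, rule allI, rule nn_integral_mono)
      fix k \<omega>
      \<comment> \<open>At a' the restricted simple process is 0 because its cells are open on the
        left, whereas the original one may be nonzero there.\<close>
      have "AE s in lborel. s \<noteq> a'" by (rule AE_lborel_singleton)
      then show "(\<integral>\<^sup>+s\<in>{a'..c'}. ennreal ((H s \<omega> - simple_process (n k) (?\<tau> k) (?\<xi> k) s \<omega>)\<^sup>2) \<partial>lborel)
          \<le> (\<integral>\<^sup>+s\<in>{a..c}. ennreal ((H s \<omega> - simple_process (n k) (\<tau> k) (\<xi> k) s \<omega>)\<^sup>2) \<partial>lborel)"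
      proof (intro nn_integral_mono_AE, eventually_elim)
        case (elim s)
        then show ?case
          using R(2)[of s k \<omega>] assms(3-5) by (auto simp: indicator_def)
      qed
    qed
  qed simp
  fix t assume t: "t \<in> {a'..c'}"
  let ?S = "\<lambda>k. simple_ito_integral B (n k) (\<tau> k) (\<xi> k)"
  show "(\<lambda>k. \<integral>\<^sup>+\<omega>. ennreal ((I t \<omega> - I a' \<omega> - simple_ito_integral B (n k) (?\<tau> k) (?\<xi> k) t \<omega>)\<^sup>2) \<partial>M)
      \<longlonglongrightarrow> 0"
  proof (rule ennreal_tendsto_0_le)
    show "(\<lambda>k. \<integral>\<^sup>+\<omega>. ennreal ((I t \<omega> - ?S k t \<omega>)\<^sup>2) \<partial>M) \<longlonglongrightarrow> 0"
      "(\<lambda>k. \<integral>\<^sup>+\<omega>. ennreal ((I a' \<omega> - ?S k a' \<omega>)\<^sup>2) \<partial>M) \<longlonglongrightarrow> 0"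
      using t assms(3-5) by (auto intro!: ito_approximationD(3)[OF A])
    fix k
    have M: "(\<lambda>\<omega>. I r \<omega> - ?S k r \<omega>) \<in> borel_measurable M" if "r \<in> {a'..c'}" for r
      using that assms(2-5)
      by (intro borel_measurable_diff I simple_ito_integral_measurable[OF ito_approximationD(1)[OF A]]) auto
    have "(\<integral>\<^sup>+\<omega>. ennreal ((I t \<omega> - I a' \<omega> - simple_ito_integral B (n k) (?\<tau> k) (?\<xi> k) t \<omega>)\<^sup>2) \<partial>M)
      = (\<integral>\<^sup>+\<omega>. ennreal (((I t \<omega> - ?S k t \<omega>) + - (I a' \<omega> - ?S k a' \<omega>))\<^sup>2) \<partial>M)"
      by (simp add: R(3)[OF t] algebra_simps)
    also have "\<dots> \<le> 2 * (\<integral>\<^sup>+\<omega>. ennreal ((I t \<omega> - ?S k t \<omega>)\<^sup>2) \<partial>M)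
        + 2 * (\<integral>\<^sup>+\<omega>. ennreal ((- (I a' \<omega> - ?S k a' \<omega>))\<^sup>2) \<partial>M)"
      using t assms(4) by (intro nn_integral_square_add_le borel_measurable_uminus M) auto
    finally show "(\<integral>\<^sup>+\<omega>. ennreal ((I t \<omega> - I a' \<omega> - simple_ito_integral B (n k) (?\<tau> k) (?\<xi> k) t \<omega>)\<^sup>2) \<partial>M)
      \<le> 2 * (\<integral>\<^sup>+\<omega>. ennreal ((I t \<omega> - ?S k t \<omega>)\<^sup>2) \<partial>M)
        + 2 * (\<integral>\<^sup>+\<omega>. ennreal ((I a' \<omega> - ?S k a' \<omega>)\<^sup>2) \<partial>M)"
      by (simp only: power2_minus)
  qed
qed

text \<open>The value at a' is subtracted because an integral over [a', c'] has to start from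
  0.\<close>

lemma has_ito_integral_on_restrict:
  assumes I: "has_ito_integral_on M B a c H I" and "0 \<le> a" "a \<le> a'" "a' \<le> c'" "c' \<le> c"
  shows "has_ito_integral_on M B a' c' H (\<lambda>t \<omega>. I t \<omega> - I a' \<omega>)"
proof -
  obtain n \<tau> \<xi> where A: "ito_approximation a c H I n \<tau> \<xi>"
    using I unfolding has_ito_integral_on_iff by blast
  have IF: "I t \<in> borel_measurable (\<F> t)" if "t \<in> {a..c}" for t
    using I that unfolding has_ito_integral_on_iff by blast
  have cont: "AE \<omega> in M. continuous_on {a..c} (\<lambda>t. I t \<omega>)"
    using I unfolding has_ito_integral_on_iff by blast
  show ?thesis
    unfolding has_ito_integral_on_iff
  proof (intro conjI ballI)
    show "progressively_measurable_on \<F> a' c' H" "square_integrable_process_on M a' c' H"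
      using I assms(3-5) progressively_measurable_restrict square_integrable_process_on_restrict
      unfolding has_ito_integral_on_iff by blast+
    show "(\<lambda>\<omega>. I t \<omega> - I a' \<omega>) \<in> borel_measurable (\<F> t)" if "t \<in> {a'..c'}" for t
      using that assms(2-5) IF[of t] measurable_filtration_mono[OF _ IF[of a'], of t]
      by (intro borel_measurable_diff) auto
    show "AE \<omega> in M. continuous_on {a'..c'} (\<lambda>t. I t \<omega> - I a' \<omega>)"
      using cont
    proof eventually_elim
      case (elim \<omega>)
      then have "continuous_on {a'..c'} (\<lambda>t. I t \<omega>)"
        using assms(3-5) by (auto intro: continuous_on_subset)
      then show ?case by (intro continuous_intros)
    qed
    show "\<exists>n \<tau> \<xi>. ito_approximation a' c' H (\<lambda>t \<omega>. I t \<omega> - I a' \<omega>) n \<tau> \<xi>"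
      using ito_approximation_restrict[OF A assms(2-5)] measurable_filtration_M[OF IF] by blast
  qed
qed

section \<open>Pasting at a common endpoint\<close>

text \<open>Counting m on both sides costs nothing in an upper bound. The process \<open>H\<close>
  is kept general so that the same estimate serves for pasted processes and for the errors of pasted
  approximations.\<close>

lemma nn_integral_square_glue_le:
  fixes a m c :: real
  assumes H1: "(\<lambda>p. indicator {a..m} (fst p) * H1 (fst p) (snd p) :: real) \<in> borel_measurable (lborel \<Otimes>\<^sub>M M)"
    and H2: "(\<lambda>p. indicator {m..c} (fst p) * H2 (fst p) (snd p) :: real) \<in> borel_measurable (lborel \<Otimes>\<^sub>M M)"
    and eq1: "\<And>s \<omega>. s \<in> {a..m} \<Longrightarrow> H s \<omega> = H1 s \<omega>"
    and eq2: "\<And>s \<omega>. s \<in> {m<..c} \<Longrightarrow> H s \<omega> = H2 s \<omega>"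
  shows "(\<integral>\<^sup>+\<omega>. (\<integral>\<^sup>+s\<in>{a..c}. ennreal ((H s \<omega>)\<^sup>2) \<partial>lborel) \<partial>M)
    \<le> (\<integral>\<^sup>+\<omega>. (\<integral>\<^sup>+s\<in>{a..m}. ennreal ((H1 s \<omega>)\<^sup>2) \<partial>lborel) \<partial>M)
     + (\<integral>\<^sup>+\<omega>. (\<integral>\<^sup>+s\<in>{m..c}. ennreal ((H2 s \<omega>)\<^sup>2) \<partial>lborel) \<partial>M)"
proof -
  have sq: "(\<lambda>x::real. x\<^sup>2) \<in> borel_measurable borel" by simp
  note M1 = set_nn_integral_process_measurable[OF H1 sq]
    and M2 = set_nn_integral_process_measurable[OF H2 sq]
  have "(\<integral>\<^sup>+s\<in>{a..c}. ennreal ((H s \<omega>)\<^sup>2) \<partial>lborel)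
      \<le> (\<integral>\<^sup>+s\<in>{a..m}. ennreal ((H1 s \<omega>)\<^sup>2) \<partial>lborel) + (\<integral>\<^sup>+s\<in>{m..c}. ennreal ((H2 s \<omega>)\<^sup>2) \<partial>lborel)"
    if "\<omega> \<in> space M" for \<omega>
  proof -
    have "(\<integral>\<^sup>+s\<in>{a..c}. ennreal ((H s \<omega>)\<^sup>2) \<partial>lborel)
      \<le> (\<integral>\<^sup>+s. ennreal ((H1 s \<omega>)\<^sup>2) * indicator {a..m} s + ennreal ((H2 s \<omega>)\<^sup>2) * indicator {m..c} s \<partial>lborel)"
    proof (rule nn_integral_mono)
      fix s
      consider "s \<in> {a..m}" | "s \<in> {m<..c}" | "s \<notin> {a..c}" by fastforce
      then show "ennreal ((H s \<omega>)\<^sup>2) * indicator {a..c} s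
          \<le> ennreal ((H1 s \<omega>)\<^sup>2) * indicator {a..m} s + ennreal ((H2 s \<omega>)\<^sup>2) * indicator {m..c} s"
        by cases (auto simp: indicator_def eq1 eq2)
    qed
    then show ?thesis by (simp only: nn_integral_add[OF M1(2)[OF that] M2(2)[OF that]])
  qed
  then have "(\<integral>\<^sup>+\<omega>. (\<integral>\<^sup>+s\<in>{a..c}. ennreal ((H s \<omega>)\<^sup>2) \<partial>lborel) \<partial>M)
    \<le> (\<integral>\<^sup>+\<omega>. (\<integral>\<^sup>+s\<in>{a..m}. ennreal ((H1 s \<omega>)\<^sup>2) \<partial>lborel)
         + (\<integral>\<^sup>+s\<in>{m..c}. ennreal ((H2 s \<omega>)\<^sup>2) \<partial>lborel) \<partial>M)"
    by (intro nn_integral_mono) auto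
  then show ?thesis by (simp only: nn_integral_add[OF M1(1) M2(1)])
qed

lemma square_integrable_process_on_glue:
  assumes "progressively_measurable_on \<F> a m H1" "progressively_measurable_on \<F> m c H2" "a \<le> m" "m \<le> c"
    and "square_integrable_process_on M a m H1" "square_integrable_process_on M m c H2"
  shows "square_integrable_process_on M a c (\<lambda>s \<omega>. if s \<le> m then H1 s \<omega> else H2 s \<omega>)"
proof -
  have "(\<integral>\<^sup>+\<omega>. (\<integral>\<^sup>+s\<in>{a..c}. ennreal ((if s \<le> m then H1 s \<omega> else H2 s \<omega>)\<^sup>2) \<partial>lborel) \<partial>M)
    \<le> (\<integral>\<^sup>+\<omega>. (\<integral>\<^sup>+s\<in>{a..m}. ennreal ((H1 s \<omega>)\<^sup>2) \<partial>lborel) \<partial>M)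
     + (\<integral>\<^sup>+\<omega>. (\<integral>\<^sup>+s\<in>{m..c}. ennreal ((H2 s \<omega>)\<^sup>2) \<partial>lborel) \<partial>M)"
    using assms by (intro nn_integral_square_glue_le progressively_measurable_joint) auto
  also have "\<dots> < \<infinity>"
    using assms(5,6) by (simp add: square_integrable_process_on_def)
  finally show ?thesis by (simp add: square_integrable_process_on_def)
qed

lemma simple_approximation_error_measurable:
  assumes "progressively_measurable_on \<F> a c H" "a \<le> c" "simple_integrand_on \<F> a c n \<tau> \<xi>"
  shows "(\<lambda>p. indicator {a..c} (fst p) * (H (fst p) (snd p) - simple_process n \<tau> \<xi> (fst p) (snd p)))
    \<in> borel_measurable (lborel \<Otimes>\<^sub>M M)"
proof -
  have "(\<lambda>p. indicator {a..c} (fst p) * simple_process n \<tau> \<xi> (fst p) (snd p)) \<in> borel_measurable (lborel \<Otimes>\<^sub>M M)"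
    by (intro borel_measurable_times simple_process_measurable[OF assms(3)] measurable_compose[OF measurable_fst]) auto
  with progressively_measurable_joint[OF assms(1,2)] show ?thesis
    unfolding right_diff_distrib by (rule borel_measurable_diff)
qed

text \<open>For each k the two partitions are appended. Each simple process vanishes on the other's
  side, so the integrand errors add. The right integral has not started up to m, and the left one
  stays frozen after m, so the integral error at t > m is the left error at m plus the right error
  at t.\<close>

lemma ito_approximation_glue:
  assumes A1: "ito_approximation a m H1 I1 n1 \<tau>1 \<xi>1" and A2: "ito_approximation m c H2 I2 n2 \<tau>2 \<xi>2"
    and H: "progressively_measurable_on \<F> a m H1" "progressively_measurable_on \<F> m c H2"
    and I1: "\<And>t. t \<in> {a..m} \<Longrightarrow> I1 t \<in> borel_measurable M"
    and I2: "\<And>t. t \<in> {m..c} \<Longrightarrow> I2 t \<in> borel_measurable M"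
    and "0 \<le> a" "a \<le> m" "m \<le> c"
  shows "ito_approximation a c (\<lambda>s \<omega>. if s \<le> m then H1 s \<omega> else H2 s \<omega>)
    (\<lambda>t \<omega>. if t \<le> m then I1 t \<omega> else I1 m \<omega> + I2 t \<omega>) (\<lambda>k. n1 k + n2 k)
    (\<lambda>k i. if i \<le> n1 k then \<tau>1 k i else \<tau>2 k (i - n1 k))
    (\<lambda>k i. if i < n1 k then \<xi>1 k i else \<xi>2 k (i - n1 k))"
    (is "ito_approximation a c ?H ?I ?n ?\<tau> ?\<xi>")
  unfolding ito_approximation_def
proof (intro conjI allI ballI)
  note S1 = ito_approximationD(1)[OF A1] and S2 = ito_approximationD(1)[OF A2]
  note S = simple_integrand_on_append[OF S1 S2]
  show "simple_integrand_on \<F> a c (?n k) (?\<tau> k) (?\<xi> k)" for k by (rule S(1))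
  let ?P = "\<lambda>k. simple_process (?n k) (?\<tau> k) (?\<xi> k)"
  let ?P1 = "\<lambda>k. simple_process (n1 k) (\<tau>1 k) (\<xi>1 k)" and ?P2 = "\<lambda>k. simple_process (n2 k) (\<tau>2 k) (\<xi>2 k)"
  let ?E1 = "\<lambda>k. \<integral>\<^sup>+\<omega>. (\<integral>\<^sup>+s\<in>{a..m}. ennreal ((H1 s \<omega> - ?P1 k s \<omega>)\<^sup>2) \<partial>lborel) \<partial>M"
  let ?E2 = "\<lambda>k. \<integral>\<^sup>+\<omega>. (\<integral>\<^sup>+s\<in>{m..c}. ennreal ((H2 s \<omega> - ?P2 k s \<omega>)\<^sup>2) \<partial>lborel) \<partial>M"
  show "(\<lambda>k. \<integral>\<^sup>+\<omega>. (\<integral>\<^sup>+s\<in>{a..c}. ennreal ((?H s \<omega> - ?P k s \<omega>)\<^sup>2) \<partial>lborel) \<partial>M) \<longlonglongrightarrow> 0"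
  proof (rule tendsto_sandwich[OF _ _ tendsto_const])
    show "(\<lambda>k. ?E1 k + ?E2 k) \<longlonglongrightarrow> 0"
      using tendsto_add[OF ito_approximationD(2)[OF A1] ito_approximationD(2)[OF A2]] by simp
    have "(\<integral>\<^sup>+\<omega>. (\<integral>\<^sup>+s\<in>{a..c}. ennreal ((?H s \<omega> - ?P k s \<omega>)\<^sup>2) \<partial>lborel) \<partial>M) \<le> ?E1 k + ?E2 k" for k
      using assms(7-9) H
      by (intro nn_integral_square_glue_le simple_approximation_error_measurable S1 S2)
        (auto simp: S(2) simple_process_outside[OF S1] simple_process_outside[OF S2])
    then show "\<forall>\<^sub>F k in sequentially.
        (\<integral>\<^sup>+\<omega>. (\<integral>\<^sup>+s\<in>{a..c}. ennreal ((?H s \<omega> - ?P k s \<omega>)\<^sup>2) \<partial>lborel) \<partial>M) \<le> ?E1 k + ?E2 k"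
      by (rule always_eventually[OF allI])
  qed simp
  fix t assume t: "t \<in> {a..c}"
  let ?S = "\<lambda>k. simple_ito_integral B (?n k) (?\<tau> k) (?\<xi> k)"
  let ?S1 = "\<lambda>k. simple_ito_integral B (n1 k) (\<tau>1 k) (\<xi>1 k)" and ?S2 = "\<lambda>k. simple_ito_integral B (n2 k) (\<tau>2 k) (\<xi>2 k)"
  show "(\<lambda>k. \<integral>\<^sup>+\<omega>. ennreal ((?I t \<omega> - ?S k t \<omega>)\<^sup>2) \<partial>M) \<longlonglongrightarrow> 0"
  proof (cases "t \<le> m")
    case True
    then have "?I t \<omega> - ?S k t \<omega> = I1 t \<omega> - ?S1 k t \<omega>" for k \<omega>
      by (simp add: S(3) simple_ito_integral_before[OF S2])
    then show ?thesis using ito_approximationD(3)[OF A1, of t] t True by simp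
  next
    case False
    then have eq: "?I t \<omega> - ?S k t \<omega> = (I1 m \<omega> - ?S1 k m \<omega>) + (I2 t \<omega> - ?S2 k t \<omega>)" for k \<omega>
      by (simp add: S(3) simple_ito_integral_after[OF S1, where t = t])
    show ?thesis
    proof (rule ennreal_tendsto_0_le)
      show "(\<lambda>k. \<integral>\<^sup>+\<omega>. ennreal ((I1 m \<omega> - ?S1 k m \<omega>)\<^sup>2) \<partial>M) \<longlonglongrightarrow> 0"
        using assms(8) by (intro ito_approximationD(3)[OF A1]) auto
      show "(\<lambda>k. \<integral>\<^sup>+\<omega>. ennreal ((I2 t \<omega> - ?S2 k t \<omega>)\<^sup>2) \<partial>M) \<longlonglongrightarrow> 0"
        using t False by (intro ito_approximationD(3)[OF A2]) auto
      show "(\<integral>\<^sup>+\<omega>. ennreal ((?I t \<omega> - ?S k t \<omega>)\<^sup>2) \<partial>M)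
        \<le> 2 * (\<integral>\<^sup>+\<omega>. ennreal ((I1 m \<omega> - ?S1 k m \<omega>)\<^sup>2) \<partial>M) + 2 * (\<integral>\<^sup>+\<omega>. ennreal ((I2 t \<omega> - ?S2 k t \<omega>)\<^sup>2) \<partial>M)" for k
        unfolding eq using t False assms(7-9)
        by (intro nn_integral_square_add_le borel_measurable_diff I1 I2
            simple_ito_integral_measurable[OF S1] simple_ito_integral_measurable[OF S2]) auto
    qed
  qed
qed

lemma has_ito_integral_on_glue:
  assumes I1: "has_ito_integral_on M B a m H1 I1" and I2: "has_ito_integral_on M B m c H2 I2"
    and "0 \<le> a" "a \<le> m" "m \<le> c"
  shows "has_ito_integral_on M B a c (\<lambda>s \<omega>. if s \<le> m then H1 s \<omega> else H2 s \<omega>)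
    (\<lambda>t \<omega>. if t \<le> m then I1 t \<omega> else I1 m \<omega> + I2 t \<omega>)"
  unfolding has_ito_integral_on_iff
proof (intro conjI ballI)
  have H: "progressively_measurable_on \<F> a m H1" "progressively_measurable_on \<F> m c H2"
    "square_integrable_process_on M a m H1" "square_integrable_process_on M m c H2"
    using I1 I2 unfolding has_ito_integral_on_iff by blast+
  have IF: "\<And>t. t \<in> {a..m} \<Longrightarrow> I1 t \<in> borel_measurable (\<F> t)" "\<And>t. t \<in> {m..c} \<Longrightarrow> I2 t \<in> borel_measurable (\<F> t)"
    using I1 I2 unfolding has_ito_integral_on_iff by blast+
  show "progressively_measurable_on \<F> a c (\<lambda>s \<omega>. if s \<le> m then H1 s \<omega> else H2 s \<omega>)"
    by (intro progressively_measurable_glue H assms)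
  show "square_integrable_process_on M a c (\<lambda>s \<omega>. if s \<le> m then H1 s \<omega> else H2 s \<omega>)"
    by (intro square_integrable_process_on_glue H assms)
  show "(\<lambda>\<omega>. if t \<le> m then I1 t \<omega> else I1 m \<omega> + I2 t \<omega>) \<in> borel_measurable (\<F> t)" if "t \<in> {a..c}" for t
  proof (cases "t \<le> m")
    case False
    then have "I1 m \<in> borel_measurable (\<F> t)"
      using assms(4) by (intro measurable_filtration_mono[OF _ IF(1)]) auto
    then show ?thesis using False that IF(2)[of t] by simp
  qed (use that IF(1) in simp)
  have "AE \<omega> in M. continuous_on {a..m} (\<lambda>t. I1 t \<omega>)" "AE \<omega> in M. continuous_on {m..c} (\<lambda>t. I2 t \<omega>)"
    using I1 I2 unfolding has_ito_integral_on_iff by blast+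
  then show "AE \<omega> in M. continuous_on {a..c} (\<lambda>t. if t \<le> m then I1 t \<omega> else I1 m \<omega> + I2 t \<omega>)"
    using has_ito_integral_on_start[OF I2 assms(5)]
  proof eventually_elim
    case (elim \<omega>)
    \<comment> \<open>Continuity across m rests on \<open>I2 m = 0\<close>, which holds almost
      surely: there both branches have the value \<open>I1 m\<close>.\<close>
    have "continuous_on ({a..m} \<union> {m..c}) (\<lambda>t. if t \<le> m then I1 t \<omega> else I1 m \<omega> + I2 t \<omega>)"
      using elim by (intro continuous_on_If continuous_intros) auto
    also have "{a..m} \<union> {m..c} = {a..c}" using assms(4,5) by auto
    finally show ?case .
  qed
  obtain n1 \<tau>1 \<xi>1 where A1: "ito_approximation a m H1 I1 n1 \<tau>1 \<xi>1"
    using I1 unfolding has_ito_integral_on_iff by blast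
  obtain n2 \<tau>2 \<xi>2 where A2: "ito_approximation m c H2 I2 n2 \<tau>2 \<xi>2"
    using I2 unfolding has_ito_integral_on_iff by blast
  show "\<exists>n \<tau> \<xi>. ito_approximation a c (\<lambda>s \<omega>. if s \<le> m then H1 s \<omega> else H2 s \<omega>)
    (\<lambda>t \<omega>. if t \<le> m then I1 t \<omega> else I1 m \<omega> + I2 t \<omega>) n \<tau> \<xi>"
    using ito_approximation_glue[OF A1 A2 H(1,2) measurable_filtration_M[OF IF(1)]
        measurable_filtration_M[OF IF(2)] assms(3-5)] by blast
qed

section \<open>Restricting and pasting solutions\<close>

lemma fbsde_solutionE:
  assumes "fbsde_solution M B b \<sigma> f a c \<eta> h X Y Z"
  obtains I J where
    "has_ito_integral_on M B a c (\<lambda>s \<omega>. \<sigma> s \<omega> (X s \<omega>, Y s \<omega>, Z s \<omega>)) I"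
    "has_ito_integral_on M B a c Z J"
    "AE \<omega> in M. \<forall>t\<in>{a..c}.
       X t \<omega> = \<eta> \<omega> + (LBINT s:{a..t}. b s \<omega> (X s \<omega>, Y s \<omega>, Z s \<omega>)) + I t \<omega> \<and>
       Y t \<omega> = h (X c \<omega>) \<omega> + (LBINT s:{t..c}. f s \<omega> (X s \<omega>, Y s \<omega>, Z s \<omega>)) - (J c \<omega> - J t \<omega>)"
  using assms unfolding fbsde_solution_def by blast

text \<open>The terminal function enters the equation only through its value at the solution's own
  \<open>X c\<close>, so agreement there is enough, even if \<open>h\<close> and \<open>h'\<close>
  differ elsewhere.\<close>

lemma fbsde_solution_cong:
  assumes "fbsde_solution M B b \<sigma> f a c \<eta> h X Y Z"
    and "AE \<omega> in M. \<eta> \<omega> = \<eta>' \<omega>" and "AE \<omega> in M. h (X c \<omega>) \<omega> = h' (X c \<omega>) \<omega>"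
  shows "fbsde_solution M B b \<sigma> f a c \<eta>' h' X Y Z"
proof -
  obtain I J where IJ: "has_ito_integral_on M B a c (\<lambda>s \<omega>. \<sigma> s \<omega> (X s \<omega>, Y s \<omega>, Z s \<omega>)) I"
    "has_ito_integral_on M B a c Z J"
    and eq: "AE \<omega> in M. \<forall>t\<in>{a..c}.
           X t \<omega> = \<eta> \<omega> + (LBINT s:{a..t}. b s \<omega> (X s \<omega>, Y s \<omega>, Z s \<omega>)) + I t \<omega> \<and>
           Y t \<omega> = h (X c \<omega>) \<omega> + (LBINT s:{t..c}. f s \<omega> (X s \<omega>, Y s \<omega>, Z s \<omega>))
                     - (J c \<omega> - J t \<omega>)"
    by (rule fbsde_solutionE[OF assms(1)])
  have "AE \<omega> in M. \<forall>t\<in>{a..c}.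
           X t \<omega> = \<eta>' \<omega> + (LBINT s:{a..t}. b s \<omega> (X s \<omega>, Y s \<omega>, Z s \<omega>)) + I t \<omega> \<and>
           Y t \<omega> = h' (X c \<omega>) \<omega> + (LBINT s:{t..c}. f s \<omega> (X s \<omega>, Y s \<omega>, Z s \<omega>))
                     - (J c \<omega> - J t \<omega>)"
    using eq assms(2,3) by eventually_elim simp
  with IJ show ?thesis
    using assms(1) unfolding fbsde_solution_def by blast
qed

lemma fbsde_solutionD:
  assumes "fbsde_solution M B b \<sigma> f a c \<eta> h X Y Z"
  shows "H \<in> {X, Y, Z} \<Longrightarrow> progressively_measurable_on \<F> a c H"
    and "H \<in> {X, Y, Z} \<Longrightarrow> square_integrable_process_on M a c H"
    and "AE \<omega> in M. set_integrable lborel {a..c} (\<lambda>s. b s \<omega> (X s \<omega>, Y s \<omega>, Z s \<omega>)) \<and>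
                 set_integrable lborel {a..c} (\<lambda>s. f s \<omega> (X s \<omega>, Y s \<omega>, Z s \<omega>))"
  using assms unfolding fbsde_solution_def by blast+

text \<open>At t = a and t = c the Lebesgue integrals run over a single point; the remaining term is
  \<open>I a\<close>, almost surely 0, in the forward equation and a difference of equal values of
  \<open>J\<close> in the backward one.\<close>

lemma fbsde_solution_boundary:
  assumes sol: "fbsde_solution M B b \<sigma> f a c \<eta> h X Y Z" and "a \<le> c"
  shows "AE \<omega> in M. X a \<omega> = \<eta> \<omega>" and "AE \<omega> in M. Y c \<omega> = h (X c \<omega>) \<omega>"
proof -
  obtain I J where I: "has_ito_integral_on M B a c (\<lambda>s \<omega>. \<sigma> s \<omega> (X s \<omega>, Y s \<omega>, Z s \<omega>)) I"
    and eq: "AE \<omega> in M. \<forall>t\<in>{a..c}.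
       X t \<omega> = \<eta> \<omega> + (LBINT s:{a..t}. b s \<omega> (X s \<omega>, Y s \<omega>, Z s \<omega>)) + I t \<omega> \<and>
       Y t \<omega> = h (X c \<omega>) \<omega> + (LBINT s:{t..c}. f s \<omega> (X s \<omega>, Y s \<omega>, Z s \<omega>)) - (J c \<omega> - J t \<omega>)"
    by (rule fbsde_solutionE[OF sol])
  show "AE \<omega> in M. X a \<omega> = \<eta> \<omega>"
    using eq has_ito_integral_on_start[OF I \<open>a \<le> c\<close>]
  proof eventually_elim
    case (elim \<omega>)
    then have "X a \<omega> = \<eta> \<omega> + (LBINT s:{a..a}. b s \<omega> (X s \<omega>, Y s \<omega>, Z s \<omega>)) + I a \<omega>"
      using \<open>a \<le> c\<close> by (meson atLeastAtMost_iff order_refl)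
    then show ?case using elim(2) unfolding set_integral_Icc_singleton by simp
  qed
  show "AE \<omega> in M. Y c \<omega> = h (X c \<omega>) \<omega>"
    using eq
  proof eventually_elim
    case (elim \<omega>)
    then have "Y c \<omega> = h (X c \<omega>) \<omega> + (LBINT s:{c..c}. f s \<omega> (X s \<omega>, Y s \<omega>, Z s \<omega>)) - (J c \<omega> - J c \<omega>)"
      using \<open>a \<le> c\<close> by (meson atLeastAtMost_iff order_refl)
    then show ?case unfolding set_integral_Icc_singleton by simp
  qed
qed

text \<open>Subtracting the forward equation at a' and the backward equation at c' from those at t
  leaves integrals over [a', t] and [t, c']; the shift of \<open>J\<close> by its value at a'
  cancels. Any \<open>h'\<close> that reproduces \<open>Y\<close> at c' is admissible, which is how
  \<open>u m\<close> enters as a terminal condition.\<close>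

lemma fbsde_solution_restrict:
  assumes sol: "fbsde_solution M B b \<sigma> f a c \<eta> h X Y Z" and "0 \<le> a" "a \<le> a'" "a' \<le> c'" "c' \<le> c"
    and terminal: "AE \<omega> in M. Y c' \<omega> = h' (X c' \<omega>) \<omega>"
  shows "fbsde_solution M B b \<sigma> f a' c' (X a') h' X Y Z"
proof -
  obtain I J where I: "has_ito_integral_on M B a c (\<lambda>s \<omega>. \<sigma> s \<omega> (X s \<omega>, Y s \<omega>, Z s \<omega>)) I"
    and J: "has_ito_integral_on M B a c Z J"
    and eq: "AE \<omega> in M. \<forall>t\<in>{a..c}.
       X t \<omega> = \<eta> \<omega> + (LBINT s:{a..t}. b s \<omega> (X s \<omega>, Y s \<omega>, Z s \<omega>)) + I t \<omega> \<and>
       Y t \<omega> = h (X c \<omega>) \<omega> + (LBINT s:{t..c}. f s \<omega> (X s \<omega>, Y s \<omega>, Z s \<omega>)) - (J c \<omega> - J t \<omega>)"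
    by (rule fbsde_solutionE[OF sol])
  have eq': "AE \<omega> in M. \<forall>t\<in>{a'..c'}.
       X t \<omega> = X a' \<omega> + (LBINT s:{a'..t}. b s \<omega> (X s \<omega>, Y s \<omega>, Z s \<omega>)) + (I t \<omega> - I a' \<omega>) \<and>
       Y t \<omega> = h' (X c' \<omega>) \<omega> + (LBINT s:{t..c'}. f s \<omega> (X s \<omega>, Y s \<omega>, Z s \<omega>))
         - ((J c' \<omega> - J a' \<omega>) - (J t \<omega> - J a' \<omega>))"
    using eq fbsde_solutionD(3)[OF sol] terminal
  proof eventually_elim
    case (elim \<omega>)
    let ?b = "\<lambda>s. b s \<omega> (X s \<omega>, Y s \<omega>, Z s \<omega>)" and ?f = "\<lambda>s. f s \<omega> (X s \<omega>, Y s \<omega>, Z s \<omega>)"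
    have E: "X t \<omega> = \<eta> \<omega> + (LBINT s:{a..t}. ?b s) + I t \<omega>"
      "Y t \<omega> = h (X c \<omega>) \<omega> + (LBINT s:{t..c}. ?f s) - (J c \<omega> - J t \<omega>)" if "t \<in> {a..c}" for t
      using elim(1) that by blast+
    show ?case
    proof
      fix t assume t: "t \<in> {a'..c'}"
      have bt: "set_integrable lborel {a..t} ?b" and ft: "set_integrable lborel {t..c} ?f"
        using elim(2) t assms(3-5) by (auto intro: set_integrable_subset)
      have "(LBINT s:{a..t}. ?b s) = (LBINT s:{a..a'}. ?b s) + (LBINT s:{a'..t}. ?b s)"
        using t assms(3) by (intro set_integral_Icc_split bt) auto
      moreover have "(LBINT s:{t..c}. ?f s) = (LBINT s:{t..c'}. ?f s) + (LBINT s:{c'..c}. ?f s)"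
        using t assms(5) by (intro set_integral_Icc_split ft) auto
      ultimately show "X t \<omega> = X a' \<omega> + (LBINT s:{a'..t}. ?b s) + (I t \<omega> - I a' \<omega>) \<and>
        Y t \<omega> = h' (X c' \<omega>) \<omega> + (LBINT s:{t..c'}. ?f s) - ((J c' \<omega> - J a' \<omega>) - (J t \<omega> - J a' \<omega>))"
        using E[of t] E(1)[of a'] E(2)[of c'] elim(3) t assms(3-5) by simp
    qed
  qed
  have D: "AE \<omega> in M. set_integrable lborel {a'..c'} (\<lambda>s. b s \<omega> (X s \<omega>, Y s \<omega>, Z s \<omega>)) \<and>
                 set_integrable lborel {a'..c'} (\<lambda>s. f s \<omega> (X s \<omega>, Y s \<omega>, Z s \<omega>))"
    using fbsde_solutionD(3)[OF sol]
    by eventually_elim (use assms(3-5) in \<open>auto intro: set_integrable_subset\<close>)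
  have "\<forall>H\<in>{X, Y, Z}. progressively_measurable_on \<F> a' c' H \<and> square_integrable_process_on M a' c' H"
    using fbsde_solutionD(1,2)[OF sol] assms(3,5)
      progressively_measurable_restrict square_integrable_process_on_restrict by meson
  with D has_ito_integral_on_restrict[OF I assms(2-5)] has_ito_integral_on_restrict[OF J assms(2-5)] eq'
  show ?thesis unfolding fbsde_solution_def by blast
qed

lemma fbsde_solution_glue:
  assumes sol1: "fbsde_solution M B b \<sigma> f a m \<eta> h1 X1 Y1 Z1"
    and sol2: "fbsde_solution M B b \<sigma> f m c (X1 m) h X2 Y2 Z2"
    and "0 \<le> a" "a \<le> m" "m < c"
    and Y2: "AE \<omega> in M. Y2 m \<omega> = h1 (X2 m \<omega>) \<omega>"
  shows "fbsde_solution M B b \<sigma> f a c \<eta> h (\<lambda>s \<omega>. if s \<le> m then X1 s \<omega> else X2 s \<omega>)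
    (\<lambda>s \<omega>. if s \<le> m then Y1 s \<omega> else Y2 s \<omega>) (\<lambda>s \<omega>. if s \<le> m then Z1 s \<omega> else Z2 s \<omega>)"
    (is "fbsde_solution M B b \<sigma> f a c \<eta> h ?X ?Y ?Z")
proof -
  note mc = less_imp_le[OF \<open>m < c\<close>]
  obtain I1 J1 where I1: "has_ito_integral_on M B a m (\<lambda>s \<omega>. \<sigma> s \<omega> (X1 s \<omega>, Y1 s \<omega>, Z1 s \<omega>)) I1"
    and J1: "has_ito_integral_on M B a m Z1 J1"
    and eq1: "AE \<omega> in M. \<forall>t\<in>{a..m}.
       X1 t \<omega> = \<eta> \<omega> + (LBINT s:{a..t}. b s \<omega> (X1 s \<omega>, Y1 s \<omega>, Z1 s \<omega>)) + I1 t \<omega> \<and>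
       Y1 t \<omega> = h1 (X1 m \<omega>) \<omega> + (LBINT s:{t..m}. f s \<omega> (X1 s \<omega>, Y1 s \<omega>, Z1 s \<omega>)) - (J1 m \<omega> - J1 t \<omega>)"
    by (rule fbsde_solutionE[OF sol1])
  obtain I2 J2 where I2: "has_ito_integral_on M B m c (\<lambda>s \<omega>. \<sigma> s \<omega> (X2 s \<omega>, Y2 s \<omega>, Z2 s \<omega>)) I2"
    and J2: "has_ito_integral_on M B m c Z2 J2"
    and eq2: "AE \<omega> in M. \<forall>t\<in>{m..c}.
       X2 t \<omega> = X1 m \<omega> + (LBINT s:{m..t}. b s \<omega> (X2 s \<omega>, Y2 s \<omega>, Z2 s \<omega>)) + I2 t \<omega> \<and>
       Y2 t \<omega> = h (X2 c \<omega>) \<omega> + (LBINT s:{t..c}. f s \<omega> (X2 s \<omega>, Y2 s \<omega>, Z2 s \<omega>)) - (J2 c \<omega> - J2 t \<omega>)"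
    by (rule fbsde_solutionE[OF sol2])
  let ?I = "\<lambda>t \<omega>. if t \<le> m then I1 t \<omega> else I1 m \<omega> + I2 t \<omega>"
  let ?J = "\<lambda>t \<omega>. if t \<le> m then J1 t \<omega> else J1 m \<omega> + J2 t \<omega>"
  \<comment> \<open>Moving the case distinction outside the coefficient presents it as a pasted
    process, the form in which integrals are pasted.\<close>
  have coeff: "\<phi> s \<omega> (?X s \<omega>, ?Y s \<omega>, ?Z s \<omega>) = (if s \<le> m then \<phi> s \<omega> (X1 s \<omega>, Y1 s \<omega>, Z1 s \<omega>)
      else \<phi> s \<omega> (X2 s \<omega>, Y2 s \<omega>, Z2 s \<omega>))" for \<phi> :: "real \<Rightarrow> 'w \<Rightarrow> real \<times> real \<times> real \<Rightarrow> real" and s \<omega>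
    by simp
  have I: "has_ito_integral_on M B a c (\<lambda>s \<omega>. \<sigma> s \<omega> (?X s \<omega>, ?Y s \<omega>, ?Z s \<omega>)) ?I"
    unfolding coeff[of \<sigma>] by (rule has_ito_integral_on_glue[OF I1 I2 assms(3,4) mc])
  have J: "has_ito_integral_on M B a c ?Z ?J"
    by (rule has_ito_integral_on_glue[OF J1 J2 assms(3,4) mc])
  have int: "AE \<omega> in M. set_integrable lborel {a..c} (\<lambda>s. b s \<omega> (?X s \<omega>, ?Y s \<omega>, ?Z s \<omega>)) \<and>
                 set_integrable lborel {a..c} (\<lambda>s. f s \<omega> (?X s \<omega>, ?Y s \<omega>, ?Z s \<omega>))"
    using fbsde_solutionD(3)[OF sol1] fbsde_solutionD(3)[OF sol2]
    unfolding coeff[of b] coeff[of f]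
    by eventually_elim (use assms(4) mc in \<open>auto intro: set_integrable_glue\<close>)
  have eq: "AE \<omega> in M. \<forall>t\<in>{a..c}.
       ?X t \<omega> = \<eta> \<omega> + (LBINT s:{a..t}. b s \<omega> (?X s \<omega>, ?Y s \<omega>, ?Z s \<omega>)) + ?I t \<omega> \<and>
       ?Y t \<omega> = h (?X c \<omega>) \<omega> + (LBINT s:{t..c}. f s \<omega> (?X s \<omega>, ?Y s \<omega>, ?Z s \<omega>)) - (?J c \<omega> - ?J t \<omega>)"
    using eq1 eq2 int Y2 fbsde_solution_boundary(1)[OF sol2 mc] has_ito_integral_on_start[OF J2 mc]
    unfolding coeff[of b] coeff[of f]
  proof eventually_elim
    case (elim \<omega>)
    let ?b1 = "\<lambda>s. b s \<omega> (X1 s \<omega>, Y1 s \<omega>, Z1 s \<omega>)" and ?f1 = "\<lambda>s. f s \<omega> (X1 s \<omega>, Y1 s \<omega>, Z1 s \<omega>)"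
    let ?b2 = "\<lambda>s. b s \<omega> (X2 s \<omega>, Y2 s \<omega>, Z2 s \<omega>)" and ?f2 = "\<lambda>s. f s \<omega> (X2 s \<omega>, Y2 s \<omega>, Z2 s \<omega>)"
    let ?b = "\<lambda>s. if s \<le> m then ?b1 s else ?b2 s" and ?f = "\<lambda>s. if s \<le> m then ?f1 s else ?f2 s"
    have E1: "X1 t \<omega> = \<eta> \<omega> + (LBINT s:{a..t}. ?b1 s) + I1 t \<omega>"
      "Y1 t \<omega> = h1 (X1 m \<omega>) \<omega> + (LBINT s:{t..m}. ?f1 s) - (J1 m \<omega> - J1 t \<omega>)" if "t \<in> {a..m}" for t
      using elim(1) that by blast+
    have E2: "X2 t \<omega> = X1 m \<omega> + (LBINT s:{m..t}. ?b2 s) + I2 t \<omega>"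
      "Y2 t \<omega> = h (X2 c \<omega>) \<omega> + (LBINT s:{t..c}. ?f2 s) - (J2 c \<omega> - J2 t \<omega>)" if "t \<in> {m..c}" for t
      using elim(2) that by blast+
    show ?case
    proof
      fix t assume t: "t \<in> {a..c}"
      have bt: "set_integrable lborel {a..t} ?b" and ft: "set_integrable lborel {t..c} ?f"
        using elim(3) t by (auto intro: set_integrable_subset)
      have X: "?X t \<omega> = \<eta> \<omega> + (LBINT s:{a..t}. ?b s) + ?I t \<omega>"
      proof (cases "t \<le> m")
        case True
        then have "(LBINT s:{a..t}. ?b s) = (LBINT s:{a..t}. ?b1 s)"
          by (intro set_integral_glue_left) auto
        then show ?thesis using E1(1)[of t] True t by simp
      next
        case False
        have "(LBINT s:{a..t}. ?b s) = (LBINT s:{a..m}. ?b s) + (LBINT s:{m..t}. ?b s)"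
          using False assms(4) by (intro set_integral_Icc_split bt) auto
        also have "\<dots> = (LBINT s:{a..m}. ?b1 s) + (LBINT s:{m..t}. ?b2 s)"
          by (intro arg_cong2[of _ _ _ _ "(+)"] set_integral_glue_left set_integral_glue_right) auto
        finally show ?thesis using E1(1)[of m] E2(1)[of t] False t assms(4) by simp
      qed
      have Y: "?Y t \<omega> = h (?X c \<omega>) \<omega> + (LBINT s:{t..c}. ?f s) - (?J c \<omega> - ?J t \<omega>)"
      proof (cases "t \<le> m")
        case True
        have "(LBINT s:{t..c}. ?f s) = (LBINT s:{t..m}. ?f s) + (LBINT s:{m..c}. ?f s)"
          using True mc by (intro set_integral_Icc_split ft) auto
        also have "\<dots> = (LBINT s:{t..m}. ?f1 s) + (LBINT s:{m..c}. ?f2 s)"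
          by (intro arg_cong2[of _ _ _ _ "(+)"] set_integral_glue_left set_integral_glue_right) auto
        \<comment> \<open>Almost surely \<open>X2 m\<close> equals \<open>X1 m\<close>, so the left
          terminal value \<open>h1 (X1 m)\<close> is \<open>Y2 m\<close> and can be replaced by the
          right backward equation at m, where \<open>J2 m = 0\<close>. Since \<open>m < c\<close> is
          strict, the pasted processes take their right values at c.\<close>
        finally show ?thesis
          using E1(2)[of t] E2(2)[of m] True t \<open>m < c\<close> elim(4-6) by simp
      next
        case False
        then have "(LBINT s:{t..c}. ?f s) = (LBINT s:{t..c}. ?f2 s)"
          by (intro set_integral_glue_right) auto
        then show ?thesis using E2(2)[of t] False t \<open>m < c\<close> by simp
      qed
      show "?X t \<omega> = \<eta> \<omega> + (LBINT s:{a..t}. ?b s) + ?I t \<omega> \<and>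
        ?Y t \<omega> = h (?X c \<omega>) \<omega> + (LBINT s:{t..c}. ?f s) - (?J c \<omega> - ?J t \<omega>)"
        using X Y by (rule conjI)
    qed
  qed
  have "\<forall>H\<in>{?X, ?Y, ?Z}. progressively_measurable_on \<F> a c H \<and> square_integrable_process_on M a c H"
    using fbsde_solutionD(1,2)[OF sol1] fbsde_solutionD(1,2)[OF sol2] assms(4) mc
    by (auto intro!: progressively_measurable_glue square_integrable_process_on_glue)
  with int I J eq show ?thesis unfolding fbsde_solution_def by blast
qed

section \<open>Second moment of the forward process at a fixed time\<close>

text \<open>The Lipschitz condition bounds the drift by its value at the origin plus
  \<open>K\<close> times the sum of the moduli of the three processes. A measurable majorant
  \<open>D\<close> is produced instead of the drift integral itself, so joint measurability of b
  along the solution never has to be established.\<close>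

lemma expectation_drift_square_finite:
  assumes A: "fbsde_standing_assumption M B T b \<sigma> f g"
    and \<Theta>: "\<And>H. H \<in> {X, Y, Z} \<Longrightarrow> progressively_measurable_on \<F> a c H"
      "\<And>H. H \<in> {X, Y, Z} \<Longrightarrow> square_integrable_process_on M a c H"
    and "0 \<le> a" "a \<le> c" "c \<le> T"
  obtains D where "D \<in> borel_measurable M" "(\<integral>\<^sup>+\<omega>. (D \<omega>)\<^sup>2 \<partial>M) < \<infinity>"
    "\<And>\<omega>. \<omega> \<in> space M \<Longrightarrow> (\<integral>\<^sup>+s\<in>{a..c}. ennreal \<bar>b s \<omega> (X s \<omega>, Y s \<omega>, Z s \<omega>)\<bar> \<partial>lborel) \<le> D \<omega>"
proof -
  have "\<exists>K0>0. (\<forall>t\<in>{0..T}. \<forall>\<omega>\<in>space M. K0-lipschitz_on UNIV (b t \<omega>) \<and>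
                K0-lipschitz_on UNIV (\<sigma> t \<omega>) \<and> K0-lipschitz_on UNIV (f t \<omega>)) \<and>
             (\<forall>\<omega>\<in>space M. K0-lipschitz_on UNIV (\<lambda>x. g x \<omega>))"
    using A unfolding fbsde_standing_assumption_def by blast
  then obtain K where K: "K > 0" "\<And>t \<omega>. t \<in> {0..T} \<Longrightarrow> \<omega> \<in> space M \<Longrightarrow> K-lipschitz_on UNIV (b t \<omega>)"
    by blast
  have pm: "progressively_measurable_on \<F> 0 T (\<lambda>t \<omega>. b t \<omega> (0, 0, 0))"
    "progressively_measurable_on \<F> 0 T (\<lambda>t \<omega>. f t \<omega> (0, 0, 0))"
    using A unfolding fbsde_standing_assumption_def by blast+
  \<comment> \<open>Including f, and integrating over all of [0, T] in \<open>D0\<close>, makes the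
    square of \<open>D0\<close> the first summand of the integrand in the standing
    assumption.\<close>
  define G where "G s \<omega> = \<bar>b s \<omega> (0, 0, 0)\<bar> + \<bar>f s \<omega> (0, 0, 0)\<bar>" for s \<omega>
  define V where "V s \<omega> = K * (\<bar>X s \<omega>\<bar> + \<bar>Y s \<omega>\<bar> + \<bar>Z s \<omega>\<bar>)" for s \<omega>
  define D0 where "D0 \<omega> = (\<integral>\<^sup>+s\<in>{0..T}. ennreal \<bar>G s \<omega>\<bar> \<partial>lborel)" for \<omega>
  define D1 where "D1 \<omega> = (\<integral>\<^sup>+s\<in>{a..c}. ennreal \<bar>V s \<omega>\<bar> \<partial>lborel)" for \<omega>
  have "0 \<le> T" using assms by linarith
  have "(\<lambda>p. indicator {0..T} (fst p) * G (fst p) (snd p))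
      = (\<lambda>p. \<bar>indicator {0..T} (fst p) * b (fst p) (snd p) (0, 0, 0)\<bar>
           + \<bar>indicator {0..T} (fst p) * f (fst p) (snd p) (0, 0, 0)\<bar>)"
    by (auto simp: G_def indicator_def fun_eq_iff)
  also have "\<dots> \<in> borel_measurable (lborel \<Otimes>\<^sub>M M)"
    by (intro borel_measurable_add borel_measurable_abs progressively_measurable_joint[OF pm(1) \<open>0 \<le> T\<close>]
        progressively_measurable_joint[OF pm(2) \<open>0 \<le> T\<close>])
  finally have GM: "(\<lambda>p. indicator {0..T} (fst p) * G (fst p) (snd p)) \<in> borel_measurable (lborel \<Otimes>\<^sub>M M)" .
  have \<Theta>M: "(\<lambda>p. indicator {a..c} (fst p) * H (fst p) (snd p)) \<in> borel_measurable (lborel \<Otimes>\<^sub>M M)"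
    if "H \<in> {X, Y, Z}" for H
    by (rule progressively_measurable_joint[OF \<Theta>(1)[OF that] \<open>a \<le> c\<close>])
  have "(\<lambda>p. indicator {a..c} (fst p) * V (fst p) (snd p))
      = (\<lambda>p. K * (\<bar>indicator {a..c} (fst p) * X (fst p) (snd p)\<bar> + \<bar>indicator {a..c} (fst p) * Y (fst p) (snd p)\<bar>
           + \<bar>indicator {a..c} (fst p) * Z (fst p) (snd p)\<bar>))"
    by (auto simp: V_def indicator_def fun_eq_iff)
  also have "\<dots> \<in> borel_measurable (lborel \<Otimes>\<^sub>M M)"
    by (intro borel_measurable_times borel_measurable_const borel_measurable_add borel_measurable_abs \<Theta>M) auto
  finally have VM: "(\<lambda>p. indicator {a..c} (fst p) * V (fst p) (snd p)) \<in> borel_measurable (lborel \<Otimes>\<^sub>M M)" .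
  have abs: "(abs :: real \<Rightarrow> real) \<in> borel_measurable borel" and sq: "(\<lambda>x::real. x\<^sup>2) \<in> borel_measurable borel"
    by auto
  note G_int = set_nn_integral_process_measurable[OF GM abs]
    and V_int = set_nn_integral_process_measurable[OF VM abs]
    and V2_int = set_nn_integral_process_measurable[OF VM sq]
  have D0: "D0 \<in> borel_measurable M" and D1: "D1 \<in> borel_measurable M"
    using G_int(1) V_int(1) unfolding D0_def D1_def by simp_all
  show thesis
  proof
    show "(\<lambda>\<omega>. D0 \<omega> + D1 \<omega>) \<in> borel_measurable M"
      using D0 D1 by (rule borel_measurable_add)
    show "(\<integral>\<^sup>+s\<in>{a..c}. ennreal \<bar>b s \<omega> (X s \<omega>, Y s \<omega>, Z s \<omega>)\<bar> \<partial>lborel) \<le> D0 \<omega> + D1 \<omega>"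
      if \<omega>: "\<omega> \<in> space M" for \<omega>
    proof -
      have "(\<integral>\<^sup>+s\<in>{a..c}. ennreal \<bar>b s \<omega> (X s \<omega>, Y s \<omega>, Z s \<omega>)\<bar> \<partial>lborel)
        \<le> (\<integral>\<^sup>+s. ennreal \<bar>G s \<omega>\<bar> * indicator {0..T} s + ennreal \<bar>V s \<omega>\<bar> * indicator {a..c} s \<partial>lborel)"
      proof (rule nn_integral_mono)
        fix s
        show "ennreal \<bar>b s \<omega> (X s \<omega>, Y s \<omega>, Z s \<omega>)\<bar> * indicator {a..c} s
          \<le> ennreal \<bar>G s \<omega>\<bar> * indicator {0..T} s + ennreal \<bar>V s \<omega>\<bar> * indicator {a..c} s"
        proof (cases "s \<in> {a..c}")
          case True
          then have s: "s \<in> {0..T}" using assms by auto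
          let ?\<theta> = "(X s \<omega>, Y s \<omega>, Z s \<omega>)"
          have "\<bar>b s \<omega> ?\<theta> - b s \<omega> (0, 0, 0)\<bar> \<le> K * norm ?\<theta>"
            using lipschitz_onD[OF K(2)[OF s \<omega>], of ?\<theta> "(0, 0, 0)"]
            by (simp add: dist_real_def dist_norm flip: zero_prod_def)
          also have "norm ?\<theta> \<le> \<bar>X s \<omega>\<bar> + (\<bar>Y s \<omega>\<bar> + \<bar>Z s \<omega>\<bar>)"
            using norm_Pair_le[of "X s \<omega>" "(Y s \<omega>, Z s \<omega>)"] norm_Pair_le[of "Y s \<omega>" "Z s \<omega>"] by simp
          finally have "\<bar>b s \<omega> ?\<theta> - b s \<omega> (0, 0, 0)\<bar> \<le> K * (\<bar>X s \<omega>\<bar> + (\<bar>Y s \<omega>\<bar> + \<bar>Z s \<omega>\<bar>))"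
            using K(1) by simp
          moreover have "\<bar>V s \<omega>\<bar> = K * (\<bar>X s \<omega>\<bar> + (\<bar>Y s \<omega>\<bar> + \<bar>Z s \<omega>\<bar>))"
            using K(1) by (simp add: V_def add.assoc abs_mult)
          ultimately have "\<bar>b s \<omega> ?\<theta>\<bar> \<le> \<bar>G s \<omega>\<bar> + \<bar>V s \<omega>\<bar>"
            unfolding G_def by linarith
          then have "ennreal \<bar>b s \<omega> ?\<theta>\<bar> \<le> ennreal \<bar>G s \<omega>\<bar> + ennreal \<bar>V s \<omega>\<bar>"
            by (simp add: ennreal_leI flip: ennreal_plus)
          then show ?thesis using True s by simp
        qed simp
      qed
      also have "\<dots> = D0 \<omega> + D1 \<omega>"
        unfolding D0_def D1_def by (rule nn_integral_add[OF G_int(2)[OF \<omega>] V_int(2)[OF \<omega>]])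
      finally show ?thesis .
    qed
    have "(\<integral>\<^sup>+\<omega>. (D0 \<omega>)\<^sup>2 \<partial>M) \<le> (\<integral>\<^sup>+\<omega>. ((\<integral>\<^sup>+t\<in>{0..T}. ennreal (\<bar>b t \<omega> (0, 0, 0)\<bar> + \<bar>f t \<omega> (0, 0, 0)\<bar>) \<partial>lborel)\<^sup>2
           + (\<integral>\<^sup>+t\<in>{0..T}. ennreal (\<bar>\<sigma> t \<omega> (0, 0, 0)\<bar>\<^sup>2) \<partial>lborel)
           + ennreal (\<bar>g 0 \<omega>\<bar>\<^sup>2)) \<partial>M)"
    proof (rule nn_integral_mono)
      fix \<omega>
      have "(D0 \<omega>)\<^sup>2 = (\<integral>\<^sup>+t\<in>{0..T}. ennreal (\<bar>b t \<omega> (0, 0, 0)\<bar> + \<bar>f t \<omega> (0, 0, 0)\<bar>) \<partial>lborel)\<^sup>2"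
        by (simp add: D0_def G_def)
      then show "(D0 \<omega>)\<^sup>2 \<le> (\<integral>\<^sup>+t\<in>{0..T}. ennreal (\<bar>b t \<omega> (0, 0, 0)\<bar> + \<bar>f t \<omega> (0, 0, 0)\<bar>) \<partial>lborel)\<^sup>2
           + (\<integral>\<^sup>+t\<in>{0..T}. ennreal (\<bar>\<sigma> t \<omega> (0, 0, 0)\<bar>\<^sup>2) \<partial>lborel)
           + ennreal (\<bar>g 0 \<omega>\<bar>\<^sup>2)"
        by (simp add: add.assoc)
    qed
    also have "\<dots> < \<infinity>" using A unfolding fbsde_standing_assumption_def by blast
    finally have D0_fin: "(\<integral>\<^sup>+\<omega>. (D0 \<omega>)\<^sup>2 \<partial>M) < \<infinity>" .
    have V_fin: "(\<integral>\<^sup>+\<omega>. (\<integral>\<^sup>+s\<in>{a..c}. ennreal ((V s \<omega>)\<^sup>2) \<partial>lborel) \<partial>M) < \<infinity>"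
    proof -
      let ?N = "\<lambda>H \<omega>. \<integral>\<^sup>+s\<in>{a..c}. ennreal ((H s \<omega>)\<^sup>2) \<partial>lborel"
      have M: "?N H \<in> borel_measurable M"
        "\<And>\<omega>. \<omega> \<in> space M \<Longrightarrow> (\<lambda>s. ennreal ((H s \<omega>)\<^sup>2) * indicator {a..c} s) \<in> borel_measurable lborel"
        if "H \<in> {X, Y, Z}" for H
        using set_nn_integral_process_measurable[OF \<Theta>M[OF that] sq] by auto
      have mx: "?N X \<in> borel_measurable M" "?N Y \<in> borel_measurable M" "?N Z \<in> borel_measurable M"
        by (rule M(1); simp)+
      have V2: "(V s \<omega>)\<^sup>2 \<le> 3 * K\<^sup>2 * ((X s \<omega>)\<^sup>2 + (Y s \<omega>)\<^sup>2 + (Z s \<omega>)\<^sup>2)" for s \<omega>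
      proof -
        \<comment> \<open>The constant is that of Cauchy-Schwarz for three terms: the gap between
          the two sides is the sum of the squares of the three pairwise differences.\<close>
        have "(x + y + z)\<^sup>2 \<le> 3 * (x\<^sup>2 + y\<^sup>2 + z\<^sup>2)" for x y z :: real
          using zero_le_power2[of "x - y"] zero_le_power2[of "x - z"] zero_le_power2[of "y - z"]
          by (simp add: power2_eq_square algebra_simps)
        from mult_left_mono[OF this[of "\<bar>X s \<omega>\<bar>" "\<bar>Y s \<omega>\<bar>" "\<bar>Z s \<omega>\<bar>"], of "K\<^sup>2"]
        show ?thesis unfolding V_def power_mult_distrib by (simp add: distrib_left mult.assoc mult.left_commute)
      qed
      have "?N V \<omega> \<le> ennreal (3 * K\<^sup>2) * (?N X \<omega> + ?N Y \<omega> + ?N Z \<omega>)" if \<omega>: "\<omega> \<in> space M" for \<omega>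
      proof -
        let ?q = "\<lambda>H s. ennreal ((H s \<omega>)\<^sup>2) * indicator {a..c} s"
        have m: "?q X \<in> borel_measurable lborel" "?q Y \<in> borel_measurable lborel" "?q Z \<in> borel_measurable lborel"
          by (rule M(2)[OF _ \<omega>]; simp)+
        have "?N V \<omega> \<le> (\<integral>\<^sup>+s. ennreal (3 * K\<^sup>2) * (?q X s + ?q Y s + ?q Z s) \<partial>lborel)"
        proof (rule nn_integral_mono)
          fix s
          show "?q V s \<le> ennreal (3 * K\<^sup>2) * (?q X s + ?q Y s + ?q Z s)"
            using ennreal_leI[OF V2[of s \<omega>]] by (cases "s \<in> {a..c}") (simp_all add: ennreal_mult flip: ennreal_plus)
        qed
        also have "\<dots> = ennreal (3 * K\<^sup>2) * (?N X \<omega> + ?N Y \<omega> + ?N Z \<omega>)"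
          using m by (simp only: nn_integral_cmult nn_integral_add borel_measurable_add)
        finally show ?thesis .
      qed
      then have "(\<integral>\<^sup>+\<omega>. ?N V \<omega> \<partial>M) \<le> (\<integral>\<^sup>+\<omega>. ennreal (3 * K\<^sup>2) * (?N X \<omega> + ?N Y \<omega> + ?N Z \<omega>) \<partial>M)"
        by (rule nn_integral_mono)
      also have "\<dots> = ennreal (3 * K\<^sup>2) * ((\<integral>\<^sup>+\<omega>. ?N X \<omega> \<partial>M) + (\<integral>\<^sup>+\<omega>. ?N Y \<omega> \<partial>M) + (\<integral>\<^sup>+\<omega>. ?N Z \<omega> \<partial>M))"
        using mx by (simp add: nn_integral_cmult nn_integral_add)
      also have "\<dots> < \<infinity>"
        using \<Theta>(2)[of X] \<Theta>(2)[of Y] \<Theta>(2)[of Z]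
        by (auto simp: square_integrable_process_on_def intro!: ennreal_mult_less_top[THEN iffD2])
      finally show ?thesis .
    qed
    have "(\<integral>\<^sup>+\<omega>. (D1 \<omega>)\<^sup>2 \<partial>M) \<le> (\<integral>\<^sup>+\<omega>. ennreal (c - a) * (\<integral>\<^sup>+s\<in>{a..c}. ennreal ((V s \<omega>)\<^sup>2) \<partial>lborel) \<partial>M)"
      unfolding D1_def by (intro nn_integral_mono set_nn_integral_square_le V_int(2) \<open>a \<le> c\<close>)
    also have "\<dots> = ennreal (c - a) * (\<integral>\<^sup>+\<omega>. (\<integral>\<^sup>+s\<in>{a..c}. ennreal ((V s \<omega>)\<^sup>2) \<partial>lborel) \<partial>M)"
      by (rule nn_integral_cmult[OF V2_int(1)])
    also have "\<dots> < \<infinity>" using V_fin by (auto intro!: ennreal_mult_less_top[THEN iffD2])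
    finally have D1_fin: "(\<integral>\<^sup>+\<omega>. (D1 \<omega>)\<^sup>2 \<partial>M) < \<infinity>" .
    have "(\<integral>\<^sup>+\<omega>. (D0 \<omega> + D1 \<omega>)\<^sup>2 \<partial>M) \<le> (\<integral>\<^sup>+\<omega>. 2 * (D0 \<omega>)\<^sup>2 + 2 * (D1 \<omega>)\<^sup>2 \<partial>M)"
      by (intro nn_integral_mono ennreal_add_square_le)
    also have "\<dots> = 2 * (\<integral>\<^sup>+\<omega>. (D0 \<omega>)\<^sup>2 \<partial>M) + 2 * (\<integral>\<^sup>+\<omega>. (D1 \<omega>)\<^sup>2 \<partial>M)"
      using D0 D1 by (simp add: nn_integral_add nn_integral_cmult)
    also have "\<dots> < \<infinity>" using D0_fin D1_fin by (auto simp: ennreal_mult_less_top)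
    finally show "(\<integral>\<^sup>+\<omega>. (D0 \<omega> + D1 \<omega>)\<^sup>2 \<partial>M) < \<infinity>" .
  qed
qed

text \<open>The forward equation writes \<open>X t\<close> as \<eta> plus the Ito integral plus the
  drift integral. The first has a second moment by hypothesis, the second through its
  approximations, and the third is dominated by the majorant \<open>D\<close>.\<close>

lemma fbsde_solution_square_integrable:
  assumes A: "fbsde_standing_assumption M B T b \<sigma> f g"
    and sol: "fbsde_solution M B b \<sigma> f a c \<eta> h X Y Z"
    and "0 \<le> a" "c \<le> T" "t \<in> {a..c}"
    and \<eta>: "\<eta> \<in> borel_measurable M" "integrable M (\<lambda>\<omega>. (\<eta> \<omega>)\<^sup>2)"
  shows "X t \<in> borel_measurable (\<F> t)" "integrable M (\<lambda>\<omega>. (X t \<omega>)\<^sup>2)"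
proof -
  show XF: "X t \<in> borel_measurable (\<F> t)"
    using fbsde_solutionD(1)[OF sol, of X] \<open>t \<in> {a..c}\<close> by (auto intro: progressively_measurable_section)
  obtain I J where I: "has_ito_integral_on M B a c (\<lambda>s \<omega>. \<sigma> s \<omega> (X s \<omega>, Y s \<omega>, Z s \<omega>)) I"
    and eq: "AE \<omega> in M. \<forall>t\<in>{a..c}.
       X t \<omega> = \<eta> \<omega> + (LBINT s:{a..t}. b s \<omega> (X s \<omega>, Y s \<omega>, Z s \<omega>)) + I t \<omega> \<and>
       Y t \<omega> = h (X c \<omega>) \<omega> + (LBINT s:{t..c}. f s \<omega> (X s \<omega>, Y s \<omega>, Z s \<omega>)) - (J c \<omega> - J t \<omega>)"
    by (rule fbsde_solutionE[OF sol])
  have "a \<le> c" using assms(5) by simp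
  obtain D where D: "D \<in> borel_measurable M" "(\<integral>\<^sup>+\<omega>. (D \<omega>)\<^sup>2 \<partial>M) < \<infinity>"
    "\<And>\<omega>. \<omega> \<in> space M \<Longrightarrow> (\<integral>\<^sup>+s\<in>{a..c}. ennreal \<bar>b s \<omega> (X s \<omega>, Y s \<omega>, Z s \<omega>)\<bar> \<partial>lborel) \<le> D \<omega>"
    using expectation_drift_square_finite[OF A fbsde_solutionD(1,2)[OF sol] assms(3) \<open>a \<le> c\<close> assms(4)] by blast
  have It: "I t \<in> borel_measurable M" by (rule has_ito_integral_on_measurable[OF I assms(5)])
  have "AE \<omega> in M. ennreal ((X t \<omega>)\<^sup>2) \<le> 2 * ennreal ((\<eta> \<omega> + I t \<omega>)\<^sup>2) + 2 * (D \<omega>)\<^sup>2"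
    using eq fbsde_solutionD(3)[OF sol] AE_space
  proof eventually_elim
    case (elim \<omega>)
    let ?b = "\<lambda>s. b s \<omega> (X s \<omega>, Y s \<omega>, Z s \<omega>)"
    let ?\<beta> = "LBINT s:{a..t}. ?b s"
    have int: "integrable lborel (\<lambda>s. indicator {a..t} s *\<^sub>R ?b s)"
      using elim(2) assms(5) set_integrable_subset[of lborel "{a..c}" ?b "{a..t}"]
      by (auto simp: set_integrable_def)
    have "ennreal \<bar>?\<beta>\<bar> \<le> (\<integral>\<^sup>+s. ennreal (norm (indicator {a..t} s *\<^sub>R ?b s)) \<partial>lborel)"
      using integral_norm_bound_ennreal[OF int] by (simp add: set_lebesgue_integral_def)
    also have "\<dots> \<le> (\<integral>\<^sup>+s\<in>{a..c}. ennreal \<bar>?b s\<bar> \<partial>lborel)"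
      using assms(5) by (intro nn_integral_mono) (auto simp: indicator_def)
    also have "\<dots> \<le> D \<omega>" by (rule D(3)[OF elim(3)])
    finally have "(ennreal \<bar>?\<beta>\<bar>)\<^sup>2 \<le> (D \<omega>)\<^sup>2" by (intro power_mono) auto
    then have \<beta>: "ennreal (?\<beta>\<^sup>2) \<le> (D \<omega>)\<^sup>2" by (simp add: ennreal_power)
    have "X t \<omega> = (\<eta> \<omega> + I t \<omega>) + ?\<beta>" using elim(1) assms(5) by simp
    then have "ennreal ((X t \<omega>)\<^sup>2) \<le> 2 * ennreal ((\<eta> \<omega> + I t \<omega>)\<^sup>2) + 2 * ennreal (?\<beta>\<^sup>2)"
      by (simp only: ennreal_square_add_le)
    also have "\<dots> \<le> 2 * ennreal ((\<eta> \<omega> + I t \<omega>)\<^sup>2) + 2 * (D \<omega>)\<^sup>2"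
      by (intro add_left_mono mult_left_mono \<beta>) simp
    finally show ?case .
  qed
  then have "(\<integral>\<^sup>+\<omega>. ennreal ((X t \<omega>)\<^sup>2) \<partial>M)
      \<le> (\<integral>\<^sup>+\<omega>. 2 * ennreal ((\<eta> \<omega> + I t \<omega>)\<^sup>2) + 2 * (D \<omega>)\<^sup>2 \<partial>M)"
    by (rule nn_integral_mono_AE)
  also have "\<dots> = 2 * (\<integral>\<^sup>+\<omega>. ennreal ((\<eta> \<omega> + I t \<omega>)\<^sup>2) \<partial>M) + 2 * (\<integral>\<^sup>+\<omega>. (D \<omega>)\<^sup>2 \<partial>M)"
    using \<eta>(1) It D(1) by (simp add: nn_integral_add nn_integral_cmult)
  also have "\<dots> < \<infinity>"
  proof -
    have "(\<integral>\<^sup>+\<omega>. ennreal ((\<eta> \<omega> + I t \<omega>)\<^sup>2) \<partial>M)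
        \<le> 2 * (\<integral>\<^sup>+\<omega>. ennreal ((\<eta> \<omega>)\<^sup>2) \<partial>M) + 2 * (\<integral>\<^sup>+\<omega>. ennreal ((I t \<omega>)\<^sup>2) \<partial>M)"
      by (rule nn_integral_square_add_le[OF \<eta>(1) It])
    also have "\<dots> < \<infinity>"
      using has_ito_integral_on_square_finite[OF I assms(3,5)] \<eta>(2)
      by (auto simp: ennreal_mult_less_top integrable_iff_bounded)
    finally show ?thesis using D(2) by (auto simp: ennreal_mult_less_top)
  qed
  finally show "integrable M (\<lambda>\<omega>. (X t \<omega>)\<^sup>2)"
    using measurable_filtration_M[OF XF] by (simp add: integrable_iff_bounded)
qed

section \<open>Concatenation along a partition of [0, T]\<close>

text \<open>The property that a decoupling field has on short intervals, for one interval of any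
  length and one initial value. It is the invariant that is carried from cell to cell.\<close>

definition decoupled_on where
  "decoupled_on b \<sigma> f u a c \<eta> \<longleftrightarrow>
     fbsde_has_unique_solution M B b \<sigma> f a c \<eta> (u c) \<and>
     (\<forall>X Y Z. fbsde_solution M B b \<sigma> f a c \<eta> (u c) X Y Z \<longrightarrow>
        (AE \<omega> in M. \<forall>t\<in>{a..c}. Y t \<omega> = u t (X t \<omega>) \<omega>))"

lemma decoupled_onD:
  assumes "decoupled_on b \<sigma> f u a c \<eta>"
  shows "\<exists>X Y Z. fbsde_solution M B b \<sigma> f a c \<eta> (u c) X Y Z"
    and "fbsde_solution M B b \<sigma> f a c \<eta> (u c) X Y Z \<Longrightarrow>
      (AE \<omega> in M. \<forall>t\<in>{a..c}. Y t \<omega> = u t (X t \<omega>) \<omega>)"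
    and "fbsde_solution M B b \<sigma> f a c \<eta> (u c) X Y Z \<Longrightarrow>
      fbsde_solution M B b \<sigma> f a c \<eta> (u c) X' Y' Z' \<Longrightarrow>
      (AE \<omega> in M. \<forall>t\<in>{a..c}. X t \<omega> = X' t \<omega> \<and> Y t \<omega> = Y' t \<omega>)"
    and "fbsde_solution M B b \<sigma> f a c \<eta> (u c) X Y Z \<Longrightarrow>
      fbsde_solution M B b \<sigma> f a c \<eta> (u c) X' Y' Z' \<Longrightarrow>
      (AE (s, \<omega>) in lborel \<Otimes>\<^sub>M M. s \<in> {a..c} \<longrightarrow> Z s \<omega> = Z' s \<omega>)"
  using assms unfolding decoupled_on_def fbsde_has_unique_solution_def by blast+

lemma decoupled_on_concat:
  assumes A: "fbsde_standing_assumption M B T b \<sigma> f g"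
    and "0 \<le> a" "a \<le> m" "m < c" "c \<le> T"
    and \<eta>: "\<eta> \<in> borel_measurable M" "integrable M (\<lambda>\<omega>. (\<eta> \<omega>)\<^sup>2)"
    and left: "decoupled_on b \<sigma> f u a m \<eta>"
    and right: "\<And>\<zeta>. \<zeta> \<in> borel_measurable (\<F> m) \<Longrightarrow> integrable M (\<lambda>\<omega>. (\<zeta> \<omega>)\<^sup>2) \<Longrightarrow>
      decoupled_on b \<sigma> f u m c \<zeta>"
  shows "decoupled_on b \<sigma> f u a c \<eta>"
proof -
  have ac: "a \<le> c" and mc: "m \<le> c" using assms(3,4) by auto
  \<comment> \<open>The right endpoint r and the terminal function are left free because this is
    applied both to solutions on [a, c] and, for existence, to a solution known on [a, m]
    only.\<close>
  have right': "decoupled_on b \<sigma> f u m c (X m)"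
    if "fbsde_solution M B b \<sigma> f a r \<eta> h X Y Z" "m \<le> r" "r \<le> c" for r h X Y Z
    using that assms(3-5) fbsde_solution_square_integrable[OF A that(1) assms(2) _ _ \<eta>, of m]
    by (intro right) auto
  have split: "fbsde_solution M B b \<sigma> f a m \<eta> (u m) X Y Z" "fbsde_solution M B b \<sigma> f m c (X m) (u c) X Y Z"
    "AE \<omega> in M. \<forall>t\<in>{m..c}. Y t \<omega> = u t (X t \<omega>) \<omega>"
    if sol: "fbsde_solution M B b \<sigma> f a c \<eta> (u c) X Y Z" for X Y Z
  proof -
    \<comment> \<open>The right piece goes first: its terminal condition is inherited from the
      solution on [a, c], while that of the left piece is not yet available.\<close>
    show R: "fbsde_solution M B b \<sigma> f m c (X m) (u c) X Y Z"
      by (rule fbsde_solution_restrict[OF sol assms(2,3) mc order_refl])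
        (rule fbsde_solution_boundary(2)[OF sol ac])
    show *: "AE \<omega> in M. \<forall>t\<in>{m..c}. Y t \<omega> = u t (X t \<omega>) \<omega>"
      by (rule decoupled_onD(2)[OF right'[OF sol mc order_refl] R])
    have "AE \<omega> in M. Y m \<omega> = u m (X m \<omega>) \<omega>"
      using * by eventually_elim (use mc in auto)
    then have "fbsde_solution M B b \<sigma> f a m (X a) (u m) X Y Z"
      by (rule fbsde_solution_restrict[OF sol assms(2) order_refl assms(3) mc])
    then show "fbsde_solution M B b \<sigma> f a m \<eta> (u m) X Y Z"
      by (rule fbsde_solution_cong[OF _ fbsde_solution_boundary(1)[OF sol ac]]) simp
  qed
  have exists: "\<exists>X Y Z. fbsde_solution M B b \<sigma> f a c \<eta> (u c) X Y Z"
  proof -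
    obtain X1 Y1 Z1 where sol1: "fbsde_solution M B b \<sigma> f a m \<eta> (u m) X1 Y1 Z1"
      using decoupled_onD(1)[OF left] by blast
    note R = right'[OF sol1 order_refl mc]
    obtain X2 Y2 Z2 where sol2: "fbsde_solution M B b \<sigma> f m c (X1 m) (u c) X2 Y2 Z2"
      using decoupled_onD(1)[OF R] by blast
    have "AE \<omega> in M. Y2 m \<omega> = u m (X2 m \<omega>) \<omega>"
      using decoupled_onD(2)[OF R sol2] by eventually_elim (use mc in auto)
    from fbsde_solution_glue[OF sol1 sol2 assms(2-4) this] show ?thesis by blast
  qed
  have unique: "(AE \<omega> in M. \<forall>t\<in>{a..c}. X t \<omega> = X' t \<omega> \<and> Y t \<omega> = Y' t \<omega>) \<and>
      (AE (s, \<omega>) in lborel \<Otimes>\<^sub>M M. s \<in> {a..c} \<longrightarrow> Z s \<omega> = Z' s \<omega>)"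
    if sol: "fbsde_solution M B b \<sigma> f a c \<eta> (u c) X Y Z"
      and sol': "fbsde_solution M B b \<sigma> f a c \<eta> (u c) X' Y' Z'" for X Y Z X' Y' Z'
  proof
    note S = split[OF sol] and S' = split[OF sol']
    have L: "AE \<omega> in M. \<forall>t\<in>{a..m}. X t \<omega> = X' t \<omega> \<and> Y t \<omega> = Y' t \<omega>"
      by (rule decoupled_onD(3)[OF left S(1) S'(1)])
    then have "AE \<omega> in M. X' m \<omega> = X m \<omega>"
      by eventually_elim (use assms(3) in auto)
    \<comment> \<open>Left uniqueness has identified the two values at m, so both right pieces solve
      the equation with the same initial value and right uniqueness becomes applicable.\<close>
    then have S2: "fbsde_solution M B b \<sigma> f m c (X m) (u c) X' Y' Z'"
      by (rule fbsde_solution_cong[OF S'(2)]) simp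
    note R = right'[OF sol mc order_refl]
    show "AE \<omega> in M. \<forall>t\<in>{a..c}. X t \<omega> = X' t \<omega> \<and> Y t \<omega> = Y' t \<omega>"
      using L decoupled_onD(3)[OF R S(2) S2]
    proof eventually_elim
      case (elim \<omega>)
      show ?case
      proof
        fix t assume "t \<in> {a..c}"
        then show "X t \<omega> = X' t \<omega> \<and> Y t \<omega> = Y' t \<omega>"
          using elim by (cases "t \<le> m") auto
      qed
    qed
    show "AE (s, \<omega>) in lborel \<Otimes>\<^sub>M M. s \<in> {a..c} \<longrightarrow> Z s \<omega> = Z' s \<omega>"
      using decoupled_onD(4)[OF left S(1) S'(1)] decoupled_onD(4)[OF R S(2) S2]
    proof eventually_elim
      case (elim p)
      then show ?case by (cases "fst p \<le> m") (auto simp: case_prod_beta)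
    qed
  qed
  have "AE \<omega> in M. \<forall>t\<in>{a..c}. Y t \<omega> = u t (X t \<omega>) \<omega>"
    if sol: "fbsde_solution M B b \<sigma> f a c \<eta> (u c) X Y Z" for X Y Z
    using decoupled_onD(2)[OF left split(1)[OF sol]] split(3)[OF sol]
  proof eventually_elim
    case (elim \<omega>)
    show ?case
    proof
      fix t assume "t \<in> {a..c}"
      then show "Y t \<omega> = u t (X t \<omega>) \<omega>"
        using elim by (cases "t \<le> m") auto
    qed
  qed
  then show ?thesis
    using exists unique unfolding decoupled_on_def fbsde_has_unique_solution_def by blast
qed

lemma decoupled_on_0_T:
  assumes A: "fbsde_standing_assumption M B T b \<sigma> f g" and "T > 0"
    and u: "decoupling_field M B T b \<sigma> f g u"
    and \<eta>: "\<eta> \<in> borel_measurable (\<F> 0)" "integrable M (\<lambda>\<omega>. (\<eta> \<omega>)\<^sup>2)"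
  shows "decoupled_on b \<sigma> f u 0 T \<eta>"
proof -
  have "\<exists>\<delta>>0. \<forall>t1 t2 \<zeta>. 0 \<le> t1 \<longrightarrow> t1 < t2 \<longrightarrow> t2 \<le> T \<longrightarrow> t2 - t1 \<le> \<delta> \<longrightarrow>
        \<zeta> \<in> borel_measurable (\<F> t1) \<longrightarrow> integrable M (\<lambda>\<omega>. (\<zeta> \<omega>)\<^sup>2) \<longrightarrow> decoupled_on b \<sigma> f u t1 t2 \<zeta>"
    using u unfolding decoupling_field_def decoupled_on_def by blast
  then obtain \<delta> where "\<delta> > 0" and local: "\<And>t1 t2 \<zeta>. 0 \<le> t1 \<Longrightarrow> t1 < t2 \<Longrightarrow> t2 \<le> T \<Longrightarrow> t2 - t1 \<le> \<delta> \<Longrightarrow>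
        \<zeta> \<in> borel_measurable (\<F> t1) \<Longrightarrow> integrable M (\<lambda>\<omega>. (\<zeta> \<omega>)\<^sup>2) \<Longrightarrow> decoupled_on b \<sigma> f u t1 t2 \<zeta>"
    by blast
  \<comment> \<open>With N above T / \<delta>, equal cells of length T / N are shorter than
    \<delta>.\<close>
  obtain N :: nat where N: "T / \<delta> < real N" using reals_Archimedean2 by blast
  have "0 < T / \<delta>" using \<open>T > 0\<close> \<open>\<delta> > 0\<close> by simp
  with N have "0 < real N" by linarith
  define d where "d = T / real N"
  have d: "0 < d" "d \<le> \<delta>" "real N * d = T"
    using N \<open>0 < real N\<close> \<open>T > 0\<close> \<open>\<delta> > 0\<close> by (simp_all add: d_def field_simps)
  \<comment> \<open>The count starts at one cell, since the local property is given for
    nondegenerate intervals; the base case is [0, d].\<close>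
  have "decoupled_on b \<sigma> f u 0 (real (Suc k) * d) \<eta>" if "Suc k \<le> N" for k
    using that
  proof (induction k)
    case 0
    have "d \<le> T" using mult_right_mono[of 1 "real N" d] 0 d by simp
    then show ?case using local[of 0 d \<eta>] d \<eta> by simp
  next
    case (Suc k)
    let ?m = "real (Suc k) * d" and ?c = "real (Suc (Suc k)) * d"
    have "real (Suc (Suc k)) \<le> real N" using Suc.prems by linarith
    then have c: "?c \<le> T" using mult_right_mono[of _ "real N" d] d by simp
    have m: "0 \<le> ?m" "?m < ?c" "?c - ?m \<le> \<delta>" using d by (simp_all add: algebra_simps)
    show ?case
    proof (rule decoupled_on_concat[OF A order_refl m(1,2) c measurable_filtration_M[OF \<eta>(1)] \<eta>(2)])
      show "decoupled_on b \<sigma> f u 0 ?m \<eta>" using Suc by simp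
      show "decoupled_on b \<sigma> f u ?m ?c \<zeta>"
        if "\<zeta> \<in> borel_measurable (\<F> ?m)" "integrable M (\<lambda>\<omega>. (\<zeta> \<omega>)\<^sup>2)" for \<zeta>
        using that by (intro local m c)
    qed
  qed
  from this[of "N - 1"] show ?thesis using \<open>0 < real N\<close> d(3) by simp
qed

end

theorem theorem2p3:
  fixes M :: "'w measure" and B :: "real \<Rightarrow> 'w \<Rightarrow> real"
    and b \<sigma> f :: "real \<Rightarrow> 'w \<Rightarrow> real \<times> real \<times> real \<Rightarrow> real"
    and g :: "real \<Rightarrow> 'w \<Rightarrow> real" and u :: "real \<Rightarrow> real \<Rightarrow> 'w \<Rightarrow> real"
    and T x :: real
  assumes "brownian_motion M B"
    and "T > 0"
    and "fbsde_standing_assumption M B T b \<sigma> f g"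
    and "decoupling_field M B T b \<sigma> f g u"
  shows "fbsde_has_unique_solution M B b \<sigma> f 0 T (\<lambda>_. x) g \<and>
    (\<forall>X Y Z. fbsde_solution M B b \<sigma> f 0 T (\<lambda>_. x) g X Y Z \<longrightarrow>
       (AE \<omega> in M. \<forall>t\<in>{0..T}. Y t \<omega> = u t (X t \<omega>) \<omega>))"
proof -
  interpret brownian_motion M B by fact
  \<comment> \<open>A constant is measurable for \<open>\<F> 0\<close> and has a finite second
    moment under a probability measure.\<close>
  have D: "decoupled_on b \<sigma> f u 0 T (\<lambda>_. x)"
    by (rule decoupled_on_0_T[OF assms(3,2,4)]) simp_all
  have terminal: "AE \<omega> in M. \<forall>y. u T y \<omega> = g y \<omega>"
    using assms(4) unfolding decoupling_field_def by blast
  \<comment> \<open>Outside a single null set \<open>u T\<close> and \<open>g\<close> agree for all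
    arguments, so the random value \<open>X T\<close> may be inserted. Equality as predicates
    transfers existence, uniqueness and the decoupling relation at once.\<close>
  have eq: "fbsde_solution M B b \<sigma> f 0 T (\<lambda>_. x) (u T) = fbsde_solution M B b \<sigma> f 0 T (\<lambda>_. x) g"
  proof (intro ext iffI)
    fix X Y Z
    assume "fbsde_solution M B b \<sigma> f 0 T (\<lambda>_. x) g X Y Z"
    then show "fbsde_solution M B b \<sigma> f 0 T (\<lambda>_. x) (u T) X Y Z"
      by (rule fbsde_solution_cong) (use terminal in \<open>auto elim!: eventually_mono\<close>)
  next
    fix X Y Z
    assume "fbsde_solution M B b \<sigma> f 0 T (\<lambda>_. x) (u T) X Y Z"
    then show "fbsde_solution M B b \<sigma> f 0 T (\<lambda>_. x) g X Y Z"
      by (rule fbsde_solution_cong) (use terminal in \<open>auto elim!: eventually_mono\<close>)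
  qed
  show ?thesis
    using D unfolding decoupled_on_def fbsde_has_unique_solution_def eq .
qed

end
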